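(* Let $G$ be a directed po-group satisfying RDP$_1$, let $I$ be a set and $\lambda,\rho:I\to I$ bijections. Put $\phi=\rho^{-1}\circ\lambda$ and $u=(1,e^I)$. Then $(\mathbb Z\ltimes_\phi G,u)$ is a unital po-group with RDP$_1$ such that $K_I^{\lambda,\rho}(G)\cong\Gamma(\mathbb Z\ltimes_\phi G,u)$ as pseudo effect algebras, and it is the unique such unital po-group up to isomorphism: if $(H,v)$ is a unital po-group with RDP$_1$ and $K_I^{\lambda,\rho}(G)\cong\Gamma(H,v)$, then $(H,v)$ and $(\mathbb Z\ltimes_\phi G,u)$ are isomorphic as unital po-groups.
   Context: Po-groups (partially ordered groups, not necessarily Abelian) are written multiplicatively with identity $e$; $G^+=\{g\in G: g\ge e\}$, $G^-=\{g\in G:g\le e\}$. $G$ is directed if any two elements have a common upper bound. A strong unit of a po-group $H$ is $u\in H^+$ such that every $h\in H$ satisfies $h\le u^k$ for some integer $k\ge1$; a unital po-group is a pair $(H,u)$ with $u$ a strong unit; isomorphisms of unital po-groups are group isomorphisms that are order isomorphisms and map strong unit to strong unit. A po-group $G$ satisfies RDP$_1$ if for all $a_1,a_2,b_1,b_2\in G^+$ with $a_1a_2=b_1b_2$ there are $c_{11},c_{12},c_{21},c_{22}\in G^+$ with $a_1=c_{11}c_{12}$, $a_2=c_{21}c_{22}$, $b_1=c_{11}c_{21}$, $b_2=c_{12}c_{22}$, and such that $e\le x\le c_{12}$ and $e\le y\le c_{21}$ imply $xy=yx$. A pseudo effect algebra is a partial algebra $(E;+,0,1)$ such that for all $a,b,c\in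 E$: (i) $a+b$ and $(a+b)+c$ exist iff $b+c$ and $a+(b+c)$ exist, and then they are equal; (ii) there are exactly one $d$ and exactly one $f$ in $E$ with $a+d=f+a=1$; (iii) if $a+b$ exists, there are $d,f\in E$ with $a+b=d+a=b+f$; (iv) if $1+a$ or $a+1$ exists then $a=0$. A homomorphism $h$ satisfies $h(1)=1$ and: if $a+b$ is defined then $h(a)+h(b)$ is defined and equals $h(a+b)$. An isomorphism is a bijective homomorphism whose inverse is a homomorphism. For a po-group $H$ and $u\in H^+$, $\Gamma(H,u)=\{h\in H: e_H\le h\le u\}$ is the pseudo effect algebra with zero $e_H$ (the identity of $H$), unit $u$, and partial sum equal to the group product whenever that product lies in $\Gamma(H,u)$. The kite $K_I^{\lambda,\rho}(G)$: its universe is the disjoint union of $(G^+)^I$ (lower part, elements written $\langle f_i\rangle$, $f_i\ge e$) and $(G^-)^I$ (upper part, elements written $\langle a_i^{-1}\rangle$, $a_i\ge e$); the constant sequence $e$ in the lower part is $0$, the constant sequence $e$ in the upper part is $1$, and these are considered distinct. The partial sum is: the sum of two upper elements is undefined; $\langle a_i^{-1}\rangle+\langle f_i\rangle=\langle a_i^{-1}f_{\rho^{-1}(i)}\rangle$ (upper part), defined iff $f_{\rho^{-1}(i)}\le a_i$ for all $i\in I$; $\langle f_i\rangle+\langle a_i^{-1}\rangle=\langle f_{\lambda^{-1}(i)}a_i^{-1}\rangle$ (upper part), defined iff $f_{\lambda^{-1}(i)}\le a_i$ for all $i\in I$; $\langle f_i\rangle+\langle g_i\rangle=\langle f_ig_i\rangle$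 (lower part), always defined. This is a pseudo effect algebra. For a bijection $\phi:I\to I$, $\mathbb Z\ltimes_\phi G$ is the po-group with underlying set $\mathbb Z\times G^I$, multiplication $(n,\langle x_i\rangle)*_\phi(m,\langle y_i\rangle)=(n+m,\langle x_iy_{\phi^n(i)}\rangle)$, identity $(0,e^I)$ ($e^I$ the constant sequence $e$), and order $(n,\langle x_i\rangle)\le(m,\langle y_i\rangle)$ iff $n<m$, or $n=m$ and $x_i\le y_i$ for all $i\in I$. *)

theory Defs
  imports "HOL-Algebra.Group"
begin

section \<open>Partially ordered groups\<close>

record 'a po_monoid = "'a monoid" +
  ple :: "'a \<Rightarrow> 'a \<Rightarrow> bool" (infix \<open>\<preceq>\<index>\<close> 50)

locale po_group = group G for G (structure) +
  assumes partial_order: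
      "partial_order_on (carrier G) {(x, y) \<in> carrier G \<times> carrier G. x \<preceq> y}"
    and mult_mono: "\<lbrakk>x \<in> carrier G; y \<in> carrier G; a \<in> carrier G; b \<in> carrier G; x \<preceq> y\<rbrakk>
      \<Longrightarrow> a \<otimes> x \<otimes> b \<preceq> a \<otimes> y \<otimes> b"

definition pos_cone :: "('a, 'm) po_monoid_scheme \<Rightarrow> 'a set" where
  "pos_cone G = {g \<in> carrier G. \<one>\<^bsub>G\<^esub> \<preceq>\<^bsub>G\<^esub> g}"

definition neg_cone :: "('a, 'm) po_monoid_scheme \<Rightarrow> 'a set" where
  "neg_cone G = {g \<in> carrier G. g \<preceq>\<^bsub>G\<^esub> \<one>\<^bsub>G\<^esub>}"

definition directed :: "('a, 'm) po_monoid_scheme \<Rightarrow> bool" where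
  "directed G \<longleftrightarrow>
    (\<forall>x\<in>carrier G. \<forall>y\<in>carrier G. \<exists>z\<in>carrier G. x \<preceq>\<^bsub>G\<^esub> z \<and> y \<preceq>\<^bsub>G\<^esub> z)"

definition strong_unit :: "('a, 'm) po_monoid_scheme \<Rightarrow> 'a \<Rightarrow> bool" where
  "strong_unit G u \<longleftrightarrow> u \<in> pos_cone G \<and>
    (\<forall>h\<in>carrier G. \<exists>k::nat. 1 \<le> k \<and> h \<preceq>\<^bsub>G\<^esub> u [^]\<^bsub>G\<^esub> k)"

definition unital_po_group :: "('a, 'm) po_monoid_scheme \<Rightarrow> 'a \<Rightarrow> bool" where
  "unital_po_group G u \<longleftrightarrow> po_group G \<and> strong_unit G u"

definition unital_iso ::
  "('a, 'm) po_monoid_scheme \<Rightarrow> 'a \<Rightarrow> ('b, 'n) po_monoid_scheme \<Rightarrow> 'b \<Rightarrow> ('a \<Rightarrow> 'b) set" where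
  "unital_iso G u H v = {h \<in> iso G H.
    (\<forall>x\<in>carrier G. \<forall>y\<in>carrier G. x \<preceq>\<^bsub>G\<^esub> y \<longleftrightarrow> h x \<preceq>\<^bsub>H\<^esub> h y) \<and> h u = v}"

definition RDP1 :: "('a, 'm) po_monoid_scheme \<Rightarrow> bool" where
  "RDP1 G \<longleftrightarrow>
    (\<forall>a1\<in>pos_cone G. \<forall>a2\<in>pos_cone G. \<forall>b1\<in>pos_cone G. \<forall>b2\<in>pos_cone G.
      a1 \<otimes>\<^bsub>G\<^esub> a2 = b1 \<otimes>\<^bsub>G\<^esub> b2 \<longrightarrow>
      (\<exists>c11\<in>pos_cone G. \<exists>c12\<in>pos_cone G. \<exists>c21\<in>pos_cone G. \<exists>c22\<in>pos_cone G.
        a1 = c11 \<otimes>\<^bsub>G\<^esub> c12 \<and> a2 = c21 \<otimes>\<^bsub>G\<^esub> c22 \<and>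
        b1 = c11 \<otimes>\<^bsub>G\<^esub> c21 \<and> b2 = c12 \<otimes>\<^bsub>G\<^esub> c22 \<and>
        (\<forall>x\<in>carrier G. \<forall>y\<in>carrier G.
          \<one>\<^bsub>G\<^esub> \<preceq>\<^bsub>G\<^esub> x \<and> x \<preceq>\<^bsub>G\<^esub> c12 \<and> \<one>\<^bsub>G\<^esub> \<preceq>\<^bsub>G\<^esub> y \<and> y \<preceq>\<^bsub>G\<^esub> c21
          \<longrightarrow> x \<otimes>\<^bsub>G\<^esub> y = y \<otimes>\<^bsub>G\<^esub> x)))"

section \<open>Pseudo effect algebras\<close>

text \<open>The partial sum is option-valued: \<open>None\<close> means that the sum does not exist.\<close>

record 'a partial_algebra = "'a partial_object" +
  psum :: "'a \<Rightarrow> 'a \<Rightarrow> 'a option" (infixl \<open>\<boxplus>\<index>\<close> 65)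
  pzero :: 'a
  punit :: 'a

locale pseudo_effect_algebra =
  fixes E (structure)
  assumes sum_closed: "\<lbrakk>a \<in> carrier E; b \<in> carrier E; a \<boxplus> b = Some s\<rbrakk> \<Longrightarrow> s \<in> carrier E"
    and zero_closed: "pzero E \<in> carrier E"
    and unit_closed: "punit E \<in> carrier E"
    and assoc: "\<lbrakk>a \<in> carrier E; b \<in> carrier E; c \<in> carrier E\<rbrakk> \<Longrightarrow>
      (\<exists>s. a \<boxplus> b = Some s \<and> s \<boxplus> c = Some t) \<longleftrightarrow> (\<exists>s. b \<boxplus> c = Some s \<and> a \<boxplus> s = Some t)"
    and right_complement: "a \<in> carrier E \<Longrightarrow> \<exists>!d. d \<in> carrier E \<and> a \<boxplus> d = Some (punit E)"
    and left_complement: "a \<in> carrier E \<Longrightarrow> \<exists>!f. f \<in> carrier E \<and> f \<boxplus> a = Some (punit E)"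
    and conjugate: "\<lbrakk>a \<in> carrier E; b \<in> carrier E; a \<boxplus> b = Some s\<rbrakk> \<Longrightarrow>
      \<exists>d\<in>carrier E. \<exists>f\<in>carrier E. d \<boxplus> a = Some s \<and> b \<boxplus> f = Some s"
    and unit_sum: "\<lbrakk>a \<in> carrier E; punit E \<boxplus> a \<noteq> None \<or> a \<boxplus> punit E \<noteq> None\<rbrakk>
      \<Longrightarrow> a = pzero E"

definition pea_hom ::
  "('a, 'm) partial_algebra_scheme \<Rightarrow> ('b, 'n) partial_algebra_scheme \<Rightarrow> ('a \<Rightarrow> 'b) set" where
  "pea_hom E F = {h \<in> carrier E \<rightarrow> carrier F. h (punit E) = punit F \<and>
    (\<forall>a\<in>carrier E. \<forall>b\<in>carrier E. \<forall>s.
      a \<boxplus>\<^bsub>E\<^esub> b = Some s \<longrightarrow> h a \<boxplus>\<^bsub>F\<^esub> h b = Some (h s))}"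

definition pea_iso ::
  "('a, 'm) partial_algebra_scheme \<Rightarrow> ('b, 'n) partial_algebra_scheme \<Rightarrow> ('a \<Rightarrow> 'b) set" where
  "pea_iso E F = {h \<in> pea_hom E F.
    bij_betw h (carrier E) (carrier F) \<and> inv_into (carrier E) h \<in> pea_hom F E}"

definition pea_isomorphic ::
  "('a, 'm) partial_algebra_scheme \<Rightarrow> ('b, 'n) partial_algebra_scheme \<Rightarrow> bool" where
  "pea_isomorphic E F \<longleftrightarrow>
    pseudo_effect_algebra E \<and> pseudo_effect_algebra F \<and> pea_iso E F \<noteq> {}"

definition Gamma :: "('a, 'm) po_monoid_scheme \<Rightarrow> 'a \<Rightarrow> 'a partial_algebra" where
  "Gamma H u = (let A = {h \<in> carrier H. \<one>\<^bsub>H\<^esub> \<preceq>\<^bsub>H\<^esub> h \<and> h \<preceq>\<^bsub>H\<^esub> u} in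
    \<lparr>carrier = A,
     psum = (\<lambda>x y. if x \<otimes>\<^bsub>H\<^esub> y \<in> A then Some (x \<otimes>\<^bsub>H\<^esub> y) else None),
     pzero = \<one>\<^bsub>H\<^esub>,
     punit = u\<rparr>)"

text \<open>
  Sequences indexed by \<open>I\<close> are functions in \<open>I \<rightarrow>\<^sub>E carrier G\<close>, that is, they are
  \<open>undefined\<close> outside \<open>I\<close>.  In the kite, \<open>Inl f\<close> is the lower element \<open>\<langle>f\<^sub>i\<rangle>\<close> and
  \<open>Inr x\<close> is the upper element whose entries are \<open>x i = a\<^sub>i\<inverse>\<close>; so \<open>a\<^sub>i\<close> appears below as
  \<open>inv\<^bsub>G\<^esub> (x i)\<close>.
\<close>

fun kite_sum :: "('a, 'm) po_monoid_scheme \<Rightarrow> 'i set \<Rightarrow> ('i \<Rightarrow> 'i) \<Rightarrow> ('i \<Rightarrow> 'i) \<Rightarrow>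
    ('i \<Rightarrow> 'a) + ('i \<Rightarrow> 'a) \<Rightarrow> ('i \<Rightarrow> 'a) + ('i \<Rightarrow> 'a) \<Rightarrow> (('i \<Rightarrow> 'a) + ('i \<Rightarrow> 'a)) option" where
  "kite_sum G I lam rho (Inr x) (Inr y) = None"
| "kite_sum G I lam rho (Inr x) (Inl f) =
    (if \<forall>i\<in>I. f (inv_into I rho i) \<preceq>\<^bsub>G\<^esub> inv\<^bsub>G\<^esub> (x i)
     then Some (Inr (\<lambda>i\<in>I. x i \<otimes>\<^bsub>G\<^esub> f (inv_into I rho i))) else None)"
| "kite_sum G I lam rho (Inl f) (Inr x) =
    (if \<forall>i\<in>I. f (inv_into I lam i) \<preceq>\<^bsub>G\<^esub> inv\<^bsub>G\<^esub> (x i)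
     then Some (Inr (\<lambda>i\<in>I. f (inv_into I lam i) \<otimes>\<^bsub>G\<^esub> x i)) else None)"
| "kite_sum G I lam rho (Inl f) (Inl g) = Some (Inl (\<lambda>i\<in>I. f i \<otimes>\<^bsub>G\<^esub> g i))"

definition kite :: "('a, 'm) po_monoid_scheme \<Rightarrow> 'i set \<Rightarrow> ('i \<Rightarrow> 'i) \<Rightarrow> ('i \<Rightarrow> 'i) \<Rightarrow>
    (('i \<Rightarrow> 'a) + ('i \<Rightarrow> 'a)) partial_algebra" where
  "kite G I lam rho =
    \<lparr>carrier = (I \<rightarrow>\<^sub>E pos_cone G) <+> (I \<rightarrow>\<^sub>E neg_cone G),
     psum = kite_sum G I lam rho,
     pzero = Inl (\<lambda>i\<in>I. \<one>\<^bsub>G\<^esub>),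
     punit = Inr (\<lambda>i\<in>I. \<one>\<^bsub>G\<^esub>)\<rparr>"

section \<open>The lexicographic semidirect product\<close>

definition bij_int_pow :: "'i set \<Rightarrow> ('i \<Rightarrow> 'i) \<Rightarrow> int \<Rightarrow> 'i \<Rightarrow> 'i" where
  "bij_int_pow I phi n =
    (if 0 \<le> n then phi ^^ nat n else inv_into I phi ^^ nat (- n))"

definition lex_semidirect :: "'i set \<Rightarrow> ('i \<Rightarrow> 'i) \<Rightarrow> ('a, 'm) po_monoid_scheme \<Rightarrow>
    (int \<times> ('i \<Rightarrow> 'a)) po_monoid" where
  "lex_semidirect I phi G =
    \<lparr>carrier = UNIV \<times> (I \<rightarrow>\<^sub>E carrier G),
     mult = (\<lambda>(n, x) (m, y). (n + m, \<lambda>i\<in>I. x i \<otimes>\<^bsub>G\<^esub> y (bij_int_pow I phi n i))),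
     one = (0, \<lambda>i\<in>I. \<one>\<^bsub>G\<^esub>),
     ple = (\<lambda>(n, x) (m, y). n < m \<or> (n = m \<and> (\<forall>i\<in>I. x i \<preceq>\<^bsub>G\<^esub> y i)))\<rparr>"

section \<open>Intervals are pseudo effect algebras\<close>

text \<open>
  Consequently, in \<open>pea_isomorphic E (Gamma H v)\<close> the requirement that the second algebra is a
  pseudo effect algebra is no restriction on a unital po-group \<open>(H, v)\<close>.
\<close>

context po_group
begin

lemma ple_refl: "x \<in> carrier G \<Longrightarrow> x \<preceq> x"
  using partial_order
  by (auto simp: partial_order_on_def preorder_on_def refl_on_def)

lemma ple_trans:
  "\<lbrakk>x \<preceq> y; y \<preceq> z; x \<in> carrier G; y \<in> carrier G; z \<in> carrier G\<rbrakk> \<Longrightarrow> x \<preceq> z"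
  using partial_order unfolding partial_order_on_def preorder_on_def trans_def by blast

lemma ple_antisym: "\<lbrakk>x \<preceq> y; y \<preceq> x; x \<in> carrier G; y \<in> carrier G\<rbrakk> \<Longrightarrow> x = y"
  using partial_order unfolding partial_order_on_def antisym_def by blast

lemma ple_mult_left: "\<lbrakk>x \<preceq> y; x \<in> carrier G; y \<in> carrier G; a \<in> carrier G\<rbrakk> \<Longrightarrow> a \<otimes> x \<preceq> a \<otimes> y"
  using mult_mono[of x y a \<one>] by simp

lemma ple_mult_right: "\<lbrakk>x \<preceq> y; x \<in> carrier G; y \<in> carrier G; a \<in> carrier G\<rbrakk> \<Longrightarrow> x \<otimes> a \<preceq> y \<otimes> a"
  using mult_mono[of x y \<one> a] by simp

lemma ple_inv_iff:
  assumes "f \<in> carrier G" "x \<in> carrier G"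
  shows "f \<preceq> inv x \<longleftrightarrow> x \<otimes> f \<preceq> \<one>" and "f \<preceq> inv x \<longleftrightarrow> f \<otimes> x \<preceq> \<one>"
proof -
  show "f \<preceq> inv x \<longleftrightarrow> x \<otimes> f \<preceq> \<one>"
    using assms ple_mult_left[of f "inv x" x] ple_mult_left[of "x \<otimes> f" \<one> "inv x"]
    by (auto simp: m_assoc[symmetric])
  show "f \<preceq> inv x \<longleftrightarrow> f \<otimes> x \<preceq> \<one>"
    using assms ple_mult_right[of f "inv x" x] ple_mult_right[of "f \<otimes> x" \<one> "inv x"]
    by (auto simp: m_assoc)
qed

lemma one_ple_conj:
  assumes "\<one> \<preceq> b" "a \<in> carrier G" "b \<in> carrier G"
  shows "\<one> \<preceq> a \<otimes> b \<otimes> inv a"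
  using mult_mono[of \<one> b a "inv a"] assms by simp

lemma one_ple_mult:
  assumes "\<one> \<preceq> a" "\<one> \<preceq> b" "a \<in> carrier G" "b \<in> carrier G"
  shows "\<one> \<preceq> a \<otimes> b" and "a \<preceq> a \<otimes> b" and "b \<preceq> a \<otimes> b"
proof -
  show "a \<preceq> a \<otimes> b" using ple_mult_left[of \<one> b a] assms by simp
  then show "\<one> \<preceq> a \<otimes> b" using ple_trans[of \<one> a "a \<otimes> b"] assms by simp
  show "b \<preceq> a \<otimes> b" using ple_mult_right[of \<one> a b] assms by simp
qed

lemma one_ple_inv: "\<lbrakk>x \<preceq> \<one>; x \<in> carrier G\<rbrakk> \<Longrightarrow> \<one> \<preceq> inv x"
  using ple_inv_iff(1)[of \<one> x] by simp

lemma inv_ple_one: "\<lbrakk>\<one> \<preceq> x; x \<in> carrier G\<rbrakk> \<Longrightarrow> inv x \<preceq> \<one>"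
  using ple_mult_left[of \<one> x "inv x"] by simp

lemma mult_ple_one:
  assumes "a \<preceq> \<one>" "b \<preceq> \<one>" "a \<in> carrier G" "b \<in> carrier G"
  shows "a \<otimes> b \<preceq> \<one>"
  using ple_trans[of "a \<otimes> b" a \<one>] ple_mult_left[of b \<one> a] assms by simp

lemma pseudo_effect_algebra_Gamma:
  assumes "u \<in> pos_cone G"
  shows "pseudo_effect_algebra (Gamma G u)"
proof -
  have u: "u \<in> carrier G" "\<one> \<preceq> u" using assms by (auto simp: pos_cone_def)
  have G: "carrier (Gamma G u) = {h \<in> carrier G. \<one> \<preceq> h \<and> h \<preceq> u}"
    "punit (Gamma G u) = u" "pzero (Gamma G u) = \<one>"
    by (simp_all add: Gamma_def Let_def)
  have S: "a \<boxplus>\<^bsub>Gamma G u\<^esub> b = Some s \<longleftrightarrow> s = a \<otimes> b \<and> a \<otimes> b \<preceq> u"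
    if "a \<in> carrier (Gamma G u)" "b \<in> carrier (Gamma G u)" for a b s
    using that by (auto simp: Gamma_def Let_def one_ple_mult)
  show ?thesis
  proof
    fix a b s
    assume ab: "a \<in> carrier (Gamma G u)" "b \<in> carrier (Gamma G u)" "a \<boxplus>\<^bsub>Gamma G u\<^esub> b = Some s"
    then show s: "s \<in> carrier (Gamma G u)"
      by (auto simp: Gamma_def Let_def split: if_splits)
    have c: "a \<in> carrier G" "b \<in> carrier G" "\<one> \<preceq> a" "\<one> \<preceq> b" using ab G by auto
    have e: "s = a \<otimes> b" "a \<otimes> b \<preceq> u" using ab S by auto
    let ?d = "a \<otimes> b \<otimes> inv a" and ?f = "inv b \<otimes> a \<otimes> b"
    have d: "\<one> \<preceq> ?d" using one_ple_conj c by blast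
    have f: "\<one> \<preceq> ?f" using one_ple_conj[of a "inv b"] c by simp
    have "?d \<preceq> a \<otimes> b" using ple_mult_left[of "inv a" \<one> "a \<otimes> b"] inv_ple_one[of a] c by simp
    then have d': "?d \<preceq> u" using ple_trans[of ?d "a \<otimes> b" u] e c u by simp
    have "?f \<preceq> a \<otimes> b"
      using ple_mult_right[of "inv b" \<one> "a \<otimes> b"] inv_ple_one[of b] c by (simp add: m_assoc)
    then have f': "?f \<preceq> u" using ple_trans[of ?f "a \<otimes> b" u] e c u by simp
    have D: "?d \<in> carrier (Gamma G u)" "?f \<in> carrier (Gamma G u)"
      using d d' f f' c G by auto
    have "?d \<otimes> a = s" "b \<otimes> ?f = s"
      using c e by (simp_all add: m_assoc, simp add: m_assoc[symmetric])
    then show "\<exists>d\<in>carrier (Gamma G u). \<exists>f\<in>carrier (Gamma G u).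
        d \<boxplus>\<^bsub>Gamma G u\<^esub> a = Some s \<and> b \<boxplus>\<^bsub>Gamma G u\<^esub> f = Some s"
      using D S ab(1,2) e by metis
  next
    show "pzero (Gamma G u) \<in> carrier (Gamma G u)" "punit (Gamma G u) \<in> carrier (Gamma G u)"
      using u by (auto simp: G ple_refl)
  next
    fix a b c t
    assume abc: "a \<in> carrier (Gamma G u)" "b \<in> carrier (Gamma G u)" "c \<in> carrier (Gamma G u)"
    then have c: "a \<in> carrier G" "b \<in> carrier G" "c \<in> carrier G"
      and p: "\<one> \<preceq> a" "\<one> \<preceq> b" "\<one> \<preceq> c" using G by auto
    have mem: "x \<otimes> y \<in> carrier (Gamma G u)"
      if "x \<otimes> y \<preceq> u" "x \<in> carrier (Gamma G u)" "y \<in> carrier (Gamma G u)" for x y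
      using that by (auto simp: G one_ple_mult)
    have "(\<exists>s. a \<boxplus>\<^bsub>Gamma G u\<^esub> b = Some s \<and> s \<boxplus>\<^bsub>Gamma G u\<^esub> c = Some t)
        \<longleftrightarrow> a \<otimes> b \<preceq> u \<and> a \<otimes> b \<otimes> c \<preceq> u \<and> t = a \<otimes> b \<otimes> c"
      using S abc mem by metis
    also have "\<dots> \<longleftrightarrow> b \<otimes> c \<preceq> u \<and> a \<otimes> b \<otimes> c \<preceq> u \<and> t = a \<otimes> b \<otimes> c"
      using one_ple_mult(2)[of "a \<otimes> b" c] one_ple_mult(3)[of a "b \<otimes> c"] c p u
        ple_trans[of "a \<otimes> b" "a \<otimes> b \<otimes> c" u] ple_trans[of "b \<otimes> c" "a \<otimes> b \<otimes> c" u]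
      by (auto simp: one_ple_mult m_assoc)
    also have "\<dots> \<longleftrightarrow> (\<exists>s. b \<boxplus>\<^bsub>Gamma G u\<^esub> c = Some s \<and> a \<boxplus>\<^bsub>Gamma G u\<^esub> s = Some t)"
      using S abc mem m_assoc[of a b c] c by metis
    finally show "(\<exists>s. a \<boxplus>\<^bsub>Gamma G u\<^esub> b = Some s \<and> s \<boxplus>\<^bsub>Gamma G u\<^esub> c = Some t)
      \<longleftrightarrow> (\<exists>s. b \<boxplus>\<^bsub>Gamma G u\<^esub> c = Some s \<and> a \<boxplus>\<^bsub>Gamma G u\<^esub> s = Some t)" .
  next
    fix a assume a: "a \<in> carrier (Gamma G u)"
    then have c: "a \<in> carrier G" "\<one> \<preceq> a" "a \<preceq> u" using G by auto
    have "\<one> \<preceq> inv a \<otimes> u" using ple_mult_left[of a u "inv a"] c u by simp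
    moreover have "inv a \<otimes> u \<preceq> u" using ple_mult_right[of "inv a" \<one> u] inv_ple_one c u by simp
    ultimately have r: "inv a \<otimes> u \<in> carrier (Gamma G u)" using G c u by auto
    have "\<one> \<preceq> u \<otimes> inv a" using ple_mult_right[of a u "inv a"] c u by simp
    moreover have "u \<otimes> inv a \<preceq> u" using ple_mult_left[of "inv a" \<one> u] inv_ple_one c u by simp
    ultimately have l: "u \<otimes> inv a \<in> carrier (Gamma G u)" using G c u by auto
    show "\<exists>!d. d \<in> carrier (Gamma G u) \<and> a \<boxplus>\<^bsub>Gamma G u\<^esub> d = Some (punit (Gamma G u))"
    proof (rule ex1I[of _ "inv a \<otimes> u"])
      show "inv a \<otimes> u \<in> carrier (Gamma G u) \<and>
          a \<boxplus>\<^bsub>Gamma G u\<^esub> (inv a \<otimes> u) = Some (punit (Gamma G u))"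
        using r S[OF a r] c u G(2) by (simp add: m_assoc[symmetric] ple_refl)
      show "d = inv a \<otimes> u"
        if "d \<in> carrier (Gamma G u) \<and> a \<boxplus>\<^bsub>Gamma G u\<^esub> d = Some (punit (Gamma G u))" for d
      proof -
        have "d \<in> carrier G" "u = a \<otimes> d" using that S[OF a, of d] G by auto
        then show ?thesis using c by (simp add: m_assoc[symmetric])
      qed
    qed
    show "\<exists>!d. d \<in> carrier (Gamma G u) \<and> d \<boxplus>\<^bsub>Gamma G u\<^esub> a = Some (punit (Gamma G u))"
    proof (rule ex1I[of _ "u \<otimes> inv a"])
      show "u \<otimes> inv a \<in> carrier (Gamma G u) \<and>
          (u \<otimes> inv a) \<boxplus>\<^bsub>Gamma G u\<^esub> a = Some (punit (Gamma G u))"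
        using l S[OF l a] c u G(2) by (simp add: m_assoc ple_refl)
      show "d = u \<otimes> inv a"
        if "d \<in> carrier (Gamma G u) \<and> d \<boxplus>\<^bsub>Gamma G u\<^esub> a = Some (punit (Gamma G u))" for d
      proof -
        have "d \<in> carrier G" "u = d \<otimes> a" using that S[OF _ a, of d] G by auto
        then show ?thesis using c by (simp add: m_assoc)
      qed
    qed
    assume "punit (Gamma G u) \<boxplus>\<^bsub>Gamma G u\<^esub> a \<noteq> None \<or> a \<boxplus>\<^bsub>Gamma G u\<^esub> punit (Gamma G u) \<noteq> None"
    then have "u \<otimes> a \<preceq> u \<or> a \<otimes> u \<preceq> u"
      by (auto simp: Gamma_def Let_def split: if_splits)
    then have "inv u \<otimes> (u \<otimes> a) \<preceq> inv u \<otimes> u \<or> a \<otimes> u \<otimes> inv u \<preceq> u \<otimes> inv u"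
      using ple_mult_left[of "u \<otimes> a" u "inv u"] ple_mult_right[of "a \<otimes> u" u "inv u"] c u by auto
    moreover have "inv u \<otimes> (u \<otimes> a) = a" using c u by (simp add: m_assoc[symmetric])
    moreover have "a \<otimes> u \<otimes> inv u = a" using c u by (simp add: m_assoc)
    ultimately have "a \<preceq> \<one>" using u by simp
    then show "a = pzero (Gamma G u)" using ple_antisym c G by simp
  qed
qed

end

end

theory Submission
  imports Defs "HOL-Algebra.Coset"
begin

text \<open>
  Shifting the upper part of the kite by \<open>\<lambda>\<close> identifies it with levels \<open>0\<close> and \<open>1\<close> of the
  semidirect product.  For \<open>RDP1\<close> of the product, a common lower bound (directedness) of two
  factors on a positive level splits off, which leaves an instance of \<open>RDP1\<close> on level \<open>0\<close>.

  For uniqueness, \<open>RDP1\<close> makes every positive element of a unital po-group a product of elements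
  of the interval, and an interval isomorphism \<open>f\<close> is extended by sending such a product
  \<open>a\<^sub>1 \<cdots> a\<^sub>k\<close> to \<open>f a\<^sub>1 \<cdots> f a\<^sub>k\<close>.  This is well defined: a factor \<open>a\<close> of \<open>b\<^sub>1 \<cdots> b\<^sub>k\<close> can be moved
  to the front by \<open>RDP1\<close> without changing the image, because \<open>f\<close> preserves commutation of the
  refining elements.  The inverse of \<open>f\<close> extends in the same way, so the positive cones are
  isomorphic, and directedness extends this to the groups.
\<close>

section \<open>Positive cones and refinements\<close>

text \<open>The commutation clause of \<open>RDP1\<close> on its own, so that it can be passed on to
  smaller \<open>c\<close> and \<open>d\<close> and turned around.\<close>

definition parts_commute :: "('a, 'm) po_monoid_scheme \<Rightarrow> 'a \<Rightarrow> 'a \<Rightarrow> bool" where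
  "parts_commute G c d \<longleftrightarrow> (\<forall>x\<in>carrier G. \<forall>y\<in>carrier G.
    \<one>\<^bsub>G\<^esub> \<preceq>\<^bsub>G\<^esub> x \<and> x \<preceq>\<^bsub>G\<^esub> c \<and> \<one>\<^bsub>G\<^esub> \<preceq>\<^bsub>G\<^esub> y \<and> y \<preceq>\<^bsub>G\<^esub> d \<longrightarrow> x \<otimes>\<^bsub>G\<^esub> y = y \<otimes>\<^bsub>G\<^esub> x)"

definition refinable :: "('a, 'm) po_monoid_scheme \<Rightarrow> 'a \<Rightarrow> 'a \<Rightarrow> 'a \<Rightarrow> 'a \<Rightarrow> bool" where
  "refinable G a1 a2 b1 b2 \<longleftrightarrow>
    (\<exists>c11\<in>pos_cone G. \<exists>c12\<in>pos_cone G. \<exists>c21\<in>pos_cone G. \<exists>c22\<in>pos_cone G.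
      a1 = c11 \<otimes>\<^bsub>G\<^esub> c12 \<and> a2 = c21 \<otimes>\<^bsub>G\<^esub> c22 \<and>
      b1 = c11 \<otimes>\<^bsub>G\<^esub> c21 \<and> b2 = c12 \<otimes>\<^bsub>G\<^esub> c22 \<and> parts_commute G c12 c21)"

lemma RDP1_iff_refinable:
  "RDP1 G \<longleftrightarrow> (\<forall>a1\<in>pos_cone G. \<forall>a2\<in>pos_cone G. \<forall>b1\<in>pos_cone G. \<forall>b2\<in>pos_cone G.
      a1 \<otimes>\<^bsub>G\<^esub> a2 = b1 \<otimes>\<^bsub>G\<^esub> b2 \<longrightarrow> refinable G a1 a2 b1 b2)"
  unfolding RDP1_def refinable_def parts_commute_def ..

lemma refinable_cases:
  assumes "refinable G a1 a2 b1 b2"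
  obtains c11 c12 c21 c22 where
    "c11 \<in> pos_cone G" "c12 \<in> pos_cone G" "c21 \<in> pos_cone G" "c22 \<in> pos_cone G"
    "a1 = c11 \<otimes>\<^bsub>G\<^esub> c12" "a2 = c21 \<otimes>\<^bsub>G\<^esub> c22"
    "b1 = c11 \<otimes>\<^bsub>G\<^esub> c21" "b2 = c12 \<otimes>\<^bsub>G\<^esub> c22" "parts_commute G c12 c21"
  using assms unfolding refinable_def by blast

lemma refinableI:
  assumes
    "c11 \<in> pos_cone G" "c12 \<in> pos_cone G" "c21 \<in> pos_cone G" "c22 \<in> pos_cone G"
    "a1 = c11 \<otimes>\<^bsub>G\<^esub> c12" "a2 = c21 \<otimes>\<^bsub>G\<^esub> c22"
    "b1 = c11 \<otimes>\<^bsub>G\<^esub> c21" "b2 = c12 \<otimes>\<^bsub>G\<^esub> c22" "parts_commute G c12 c21"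
  shows "refinable G a1 a2 b1 b2"
  using assms unfolding refinable_def by blast

lemma parts_commute_sym: "parts_commute G c d \<Longrightarrow> parts_commute G d c"
  unfolding parts_commute_def by metis

text \<open>Transposing the matrix of the \<open>c\<close>s swaps the two factorizations; it
  exchanges \<open>c12\<close> and \<open>c21\<close>, and the commutation clause is
  symmetric.\<close>

lemma refinable_sym: "refinable G a1 a2 b1 b2 \<Longrightarrow> refinable G b1 b2 a1 a2"
  by (elim refinable_cases, rule refinableI) (assumption | rule parts_commute_sym)+

context po_group
begin

lemma pos_coneD: "x \<in> pos_cone G \<Longrightarrow> x \<in> carrier G" "x \<in> pos_cone G \<Longrightarrow> \<one> \<preceq> x"
  by (auto simp: pos_cone_def)

lemma one_pos_cone: "\<one> \<in> pos_cone G"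
  by (simp add: pos_cone_def ple_refl)

lemma mult_pos_cone: "\<lbrakk>x \<in> pos_cone G; y \<in> pos_cone G\<rbrakk> \<Longrightarrow> x \<otimes> y \<in> pos_cone G"
  by (simp add: pos_cone_def one_ple_mult)

lemma ple_iff_pos_cone:
  assumes "x \<in> carrier G" "y \<in> carrier G"
  shows "x \<preceq> y \<longleftrightarrow> inv x \<otimes> y \<in> pos_cone G" and "x \<preceq> y \<longleftrightarrow> y \<otimes> inv x \<in> pos_cone G"
proof -
  show "x \<preceq> y \<longleftrightarrow> inv x \<otimes> y \<in> pos_cone G"
    using ple_mult_left[of x y "inv x"] ple_mult_left[of \<one> "inv x \<otimes> y" x] assms
    by (auto simp: pos_cone_def m_assoc[symmetric])
  show "x \<preceq> y \<longleftrightarrow> y \<otimes> inv x \<in> pos_cone G"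
    using ple_mult_right[of x y "inv x"] ple_mult_right[of \<one> "y \<otimes> inv x" x] assms
    by (auto simp: pos_cone_def m_assoc)
qed

lemma ple_mult_pos:
  assumes "x \<in> pos_cone G" "y \<in> pos_cone G"
  shows "x \<preceq> x \<otimes> y" and "y \<preceq> x \<otimes> y"
  using one_ple_mult[of x y] assms by (auto simp: pos_cone_def)

lemma mult_eq_one_pos:
  assumes "x \<in> pos_cone G" "y \<in> pos_cone G" "x \<otimes> y = \<one>"
  shows "x = \<one>" and "y = \<one>"
  using ple_mult_pos[of x y] assms ple_antisym[of x \<one>] ple_antisym[of y \<one>]
  by (auto simp: pos_cone_def)

lemma parts_commute_one: "c \<in> carrier G \<Longrightarrow> parts_commute G \<one> c"
  using ple_antisym one_closed unfolding parts_commute_def by (metis l_one r_one)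

lemma parts_commute_mono:
  assumes "parts_commute G c d" "x \<in> carrier G" "c \<in> carrier G" "x \<preceq> c"
    "y \<in> carrier G" "d \<in> carrier G" "y \<preceq> d"
  shows "parts_commute G x y"
  using assms ple_trans unfolding parts_commute_def by metis

lemma parts_commuteD:
  assumes "parts_commute G c d" "c \<in> pos_cone G" "d \<in> pos_cone G"
  shows "c \<otimes> d = d \<otimes> c"
  using assms ple_refl unfolding parts_commute_def pos_cone_def by blast

text \<open>The new factor is absorbed into \<open>c11\<close>, the first piece of both
  \<open>a1\<close> and \<open>b1\<close>, so the commuting pair \<open>c12\<close>,
  \<open>c21\<close> stays as it was.\<close>

lemma refinable_mult_left:
  assumes "refinable G a1 a2 b1 b2" "c \<in> pos_cone G"
  shows "refinable G (c \<otimes> a1) a2 (c \<otimes> b1) b2"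
  using assms(1)
proof (cases rule: refinable_cases)
  case (1 c11 c12 c21 c22)
  show ?thesis
    by (rule refinableI[of "c \<otimes> c11" _ c12 c21 c22])
      (use 1 assms(2) in \<open>auto intro: mult_pos_cone simp: m_assoc pos_coneD\<close>)
qed

lemma refinable_mult_right:
  assumes "refinable G a1 a2 b1 b2" "c \<in> pos_cone G"
  shows "refinable G a1 (a2 \<otimes> c) b1 (b2 \<otimes> c)"
  using assms(1)
proof (cases rule: refinable_cases)
  case (1 c11 c12 c21 c22)
  show ?thesis
    by (rule refinableI[of c11 _ c12 c21 "c22 \<otimes> c"])
      (use 1 assms(2) in \<open>auto intro: mult_pos_cone simp: m_assoc pos_coneD\<close>)
qed

text \<open>Comparable first factors have a triangular refinement: with \<open>c12 = \<one>\<close>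
  the commutation clause is trivial, and \<open>c21\<close> is the gap between \<open>a1\<close> and
  \<open>b1\<close>.\<close>

lemma refinable_if_ple:
  assumes "a1 \<in> pos_cone G" "b1 \<in> pos_cone G" "a2 \<in> carrier G" "b2 \<in> pos_cone G"
    "a1 \<otimes> a2 = b1 \<otimes> b2" "a1 \<preceq> b1"
  shows "refinable G a1 a2 b1 b2"
proof (rule refinableI[of a1 _ \<one> "inv a1 \<otimes> b1" b2])
  have c: "a1 \<in> carrier G" "b1 \<in> carrier G" "b2 \<in> carrier G"
    using assms pos_coneD by blast+
  show "inv a1 \<otimes> b1 \<in> pos_cone G" using ple_iff_pos_cone(1) c assms by blast
  have "a2 = inv a1 \<otimes> (a1 \<otimes> a2)" using c assms(3) by (simp add: m_assoc[symmetric])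
  then show "a2 = inv a1 \<otimes> b1 \<otimes> b2" using c assms by (simp add: m_assoc)
  show "b1 = a1 \<otimes> (inv a1 \<otimes> b1)" using c by (simp add: m_assoc[symmetric])
qed (use assms in \<open>auto intro: one_pos_cone parts_commute_one simp: pos_coneD\<close>)

lemma directed_lower_bound:
  assumes "directed G" "x \<in> carrier G" "y \<in> carrier G"
  shows "\<exists>z\<in>carrier G. z \<preceq> x \<and> z \<preceq> y"
proof -
  obtain z where z: "z \<in> carrier G" "inv x \<preceq> z" "inv y \<preceq> z"
    using assms unfolding directed_def by (meson inv_closed)
  \<comment> \<open>Both inequalities say that \<open>w \<otimes> z\<close> is positive.\<close>
  have "inv z \<preceq> w" if "inv w \<preceq> z" "w \<in> carrier G" for w
    using ple_iff_pos_cone(1)[of "inv w" z] ple_iff_pos_cone(2)[of "inv z" w] that z(1) by simp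
  then show ?thesis using z assms by (meson inv_closed)
qed

text \<open>Two powers of \<open>u\<close> lie below their product, which is again a power.\<close>

lemma strong_unit_directed:
  assumes "strong_unit G u"
  shows "directed G"
  unfolding directed_def
proof (intro ballI)
  fix x y assume xy: "x \<in> carrier G" "y \<in> carrier G"
  have u: "u \<in> pos_cone G" using assms by (simp add: strong_unit_def)
  then have uc: "u \<in> carrier G" by (rule pos_coneD)
  have p: "u [^] k \<in> pos_cone G" for k :: nat
    by (induction k) (use u in \<open>auto intro: one_pos_cone mult_pos_cone\<close>)
  obtain k l :: nat where kl: "x \<preceq> u [^] k" "y \<preceq> u [^] l"
    using assms xy unfolding strong_unit_def by blast
  have "u [^] k \<preceq> u [^] (k + l)" "u [^] l \<preceq> u [^] (k + l)"
    using ple_mult_pos[OF p[of k] p[of l]] uc by (simp_all add: nat_pow_mult)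
  then show "\<exists>z\<in>carrier G. x \<preceq> z \<and> y \<preceq> z"
    using kl xy uc ple_trans by (meson nat_pow_closed)
qed

end

section \<open>Integer powers of a bijection\<close>

lemma bij_int_pow_0: "bij_int_pow I phi 0 i = i"
  by (simp add: bij_int_pow_def)

lemma bij_int_pow_1: "bij_int_pow I phi 1 i = phi i"
  by (simp add: bij_int_pow_def)

context
  fixes I :: "'i set" and phi :: "'i \<Rightarrow> 'i"
  assumes bij: "bij_betw phi I I"
begin

lemma bij_int_pow_mem:
  assumes "i \<in> I"
  shows "bij_int_pow I phi n i \<in> I"
proof -
  have "(phi ^^ k) i \<in> I" "(inv_into I phi ^^ k) i \<in> I" for k
    using assms bij bij_betw_inv_into[OF bij]
    by (induction k) (auto dest: bij_betwE)
  then show ?thesis by (simp add: bij_int_pow_def)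
qed

lemma bij_int_pow_succ:
  assumes "i \<in> I"
  shows "bij_int_pow I phi (n + 1) i = phi (bij_int_pow I phi n i)"
proof (cases "0 \<le> n")
  case True
  then have "nat (n + 1) = Suc (nat n)" by simp
  then show ?thesis using True by (simp add: bij_int_pow_def)
next
  case False
  \<comment> \<open>Thus \<open>n = -(k + 1)\<close>, and \<open>k\<close> inverse steps remain
    after one step of \<open>phi\<close>. For \<open>k = 0\<close> the exponent reaches
    \<open>0\<close>, where the definition changes branch.\<close>
  define k where "k = nat (- n - 1)"
  have n: "n = - int (Suc k)" using False by (simp add: k_def)
  have "bij_int_pow I phi (n + 1) i = (inv_into I phi ^^ k) i"
    by (auto simp: n bij_int_pow_def)
  moreover have "bij_int_pow I phi n i = inv_into I phi ((inv_into I phi ^^ k) i)"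
    by (simp add: n bij_int_pow_def nat_add_distrib)
  moreover have "(inv_into I phi ^^ k) i \<in> I"
    by (induction k) (use assms bij_betw_inv_into[OF bij] in \<open>auto dest: bij_betwE\<close>)
  ultimately show ?thesis using bij by (simp add: bij_betw_inv_into_right)
qed

lemma bij_int_pow_add:
  assumes "i \<in> I"
  shows "bij_int_pow I phi (n + m) i = bij_int_pow I phi m (bij_int_pow I phi n i)"
proof (induction m rule: int_induct[of _ 0])
  case base
  show ?case by (simp add: bij_int_pow_0)
next
  case (step1 m)
  then show ?case
    using bij_int_pow_succ[OF assms, of "n + m"] bij_int_pow_succ[of "bij_int_pow I phi n i" m]
      bij_int_pow_mem[OF assms] by (simp add: add.assoc)
next
  case (step2 m)
  let ?j = "bij_int_pow I phi n i"
  have j: "?j \<in> I" using assms by (rule bij_int_pow_mem)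
  \<comment> \<open>Downward, the claim is shown after applying \<open>phi\<close>, which raises
    both exponents to those of the induction hypothesis; injectivity of \<open>phi\<close> then
    removes it.\<close>
  have "phi (bij_int_pow I phi (n + (m - 1)) i) = phi (bij_int_pow I phi (m - 1) ?j)"
    using bij_int_pow_succ[OF assms, of "n + (m - 1)"] bij_int_pow_succ[OF j, of "m - 1"] step2
    by simp
  then show ?case
    using bij bij_int_pow_mem assms j by (auto simp: bij_betw_def dest: inj_onD)
qed

end

section \<open>Extending maps from an interval to the whole group\<close>

text \<open>A relation rather than a function: \<open>h\<close> may have many factorizations into
  positive elements below \<open>v\<close>, and each of them relates \<open>h\<close> to the product
  of the images. That all these products agree is \<open>R_functional\<close>.\<close>

inductive ext_rel :: "('a, 'm) po_monoid_scheme \<Rightarrow> 'a \<Rightarrow> ('b, 'n) monoid_scheme \<Rightarrow> ('a \<Rightarrow> 'b) \<Rightarrow>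
    'a \<Rightarrow> 'b \<Rightarrow> bool" for H v P f where
  one: "ext_rel H v P f \<one>\<^bsub>H\<^esub> \<one>\<^bsub>P\<^esub>"
| mult: "\<lbrakk>a \<in> pos_cone H; a \<preceq>\<^bsub>H\<^esub> v; ext_rel H v P f h p\<rbrakk>
    \<Longrightarrow> ext_rel H v P f (a \<otimes>\<^bsub>H\<^esub> h) (f a \<otimes>\<^bsub>P\<^esub> p)"

text \<open>Used in both directions, for an interval isomorphism and for its inverse. Nothing is
  known about \<open>f\<close> outside the interval, so \<open>f_mult\<close> requires the product
  to lie below \<open>v\<close>, which bounds the factors as well.\<close>

locale interval_hom = H: po_group H + P: group P
  for H :: "('a, 'm) po_monoid_scheme" (structure) and P :: "('b, 'n) monoid_scheme" +
  fixes v :: 'a and f :: "'a \<Rightarrow> 'b"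
  assumes v_pos: "v \<in> pos_cone H"
    and rdp1: "RDP1 H"
    and f_closed: "\<lbrakk>a \<in> pos_cone H; a \<preceq> v\<rbrakk> \<Longrightarrow> f a \<in> carrier P"
    and f_mult: "\<lbrakk>a \<in> pos_cone H; b \<in> pos_cone H; a \<otimes> b \<preceq> v\<rbrakk> \<Longrightarrow> f (a \<otimes> b) = f a \<otimes>\<^bsub>P\<^esub> f b"
begin

abbreviation R :: "'a \<Rightarrow> 'b \<Rightarrow> bool" where
  "R \<equiv> ext_rel H v P f"

lemma refine:
  "\<lbrakk>a1 \<in> pos_cone H; a2 \<in> pos_cone H; b1 \<in> pos_cone H; b2 \<in> pos_cone H; a1 \<otimes> a2 = b1 \<otimes> b2\<rbrakk>
    \<Longrightarrow> refinable H a1 a2 b1 b2"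
  using rdp1 unfolding RDP1_iff_refinable by blast

lemma left_factor_ple:
  assumes "x \<in> pos_cone H" "y \<in> pos_cone H" "x \<otimes> y \<preceq> v"
  shows "x \<preceq> v"
  using H.ple_trans[of x "x \<otimes> y" v] H.ple_mult_pos[of x y] assms v_pos
  by (simp add: H.pos_coneD)

lemma right_factor_ple:
  assumes "x \<in> pos_cone H" "y \<in> pos_cone H" "x \<otimes> y \<preceq> v"
  shows "y \<preceq> v"
  using H.ple_trans[of y "x \<otimes> y" v] H.ple_mult_pos[of x y] assms v_pos
  by (simp add: H.pos_coneD)

lemma f_one: "f \<one> = \<one>\<^bsub>P\<^esub>"
proof -
  have le: "\<one> \<preceq> v" using v_pos by (rule H.pos_coneD)
  have "f \<one> = f \<one> \<otimes>\<^bsub>P\<^esub> f \<one>"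
    using f_mult[of \<one> \<one>] H.one_pos_cone le by simp
  then show ?thesis using f_closed[OF H.one_pos_cone le] by simp
qed

text \<open>
  The product \<open>a \<otimes> b\<close> need not lie below \<open>v\<close>, so \<open>f_mult\<close> does not apply to it.  Refining
  \<open>a \<otimes> (inv a \<otimes> v) = b \<otimes> (inv b \<otimes> v)\<close> splits \<open>b\<close> into a part \<open>c21\<close> with \<open>a \<otimes> c21 \<preceq> v\<close> and a
  common part \<open>c11\<close> of \<open>a\<close> and \<open>b\<close>, and \<open>f a\<close> commutes with the image of each.
\<close>

lemma f_commute:
  assumes a: "a \<in> pos_cone H" "a \<preceq> v" and b: "b \<in> pos_cone H" "b \<preceq> v"
    and ab: "parts_commute H a b"
  shows "f a \<otimes>\<^bsub>P\<^esub> f b = f b \<otimes>\<^bsub>P\<^esub> f a"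
proof -
  have c: "a \<in> carrier H" "b \<in> carrier H" "v \<in> carrier H"
    using a b v_pos H.pos_coneD by blast+
  have "inv a \<otimes> v \<in> pos_cone H" "inv b \<otimes> v \<in> pos_cone H"
    using c a b H.ple_iff_pos_cone(1) by blast+
  moreover have "a \<otimes> (inv a \<otimes> v) = v" "b \<otimes> (inv b \<otimes> v) = v"
    using c by (simp_all add: H.m_assoc[symmetric])
  ultimately have "refinable H a (inv a \<otimes> v) b (inv b \<otimes> v)"
    using refine a b by metis
  then show ?thesis
  proof (cases rule: refinable_cases)
    case (1 c11 c12 c21 c22)
    have cc: "c11 \<in> carrier H" "c12 \<in> carrier H" "c21 \<in> carrier H" "c22 \<in> carrier H"
      using 1 H.pos_coneD by blast+
    have le: "c11 \<preceq> v" "c12 \<preceq> v" "c21 \<preceq> v"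
      using 1(1-4) 1(5,7)[symmetric] a b left_factor_ple right_factor_ple by metis+
    have cl: "f c11 \<in> carrier P" "f c12 \<in> carrier P" "f c21 \<in> carrier P"
      "f a \<in> carrier P"
      using le 1 a f_closed by blast+
    have sub: "c12 \<preceq> a" "c11 \<preceq> b" "c21 \<preceq> b"
      using H.ple_mult_pos 1 by metis+
    \<comment> \<open>\<open>c21\<close> is a part of \<open>b\<close>, so it commutes with
      \<open>a\<close>. Both orders of the product lie below \<open>v\<close>, since
      \<open>v = a \<otimes> c21 \<otimes> c22\<close>, and \<open>f_mult\<close> applies to
      each.\<close>
    have "a \<otimes> c21 = c21 \<otimes> a"
      using H.parts_commuteD H.parts_commute_mono[OF ab] sub cc c 1 a H.ple_refl by metis
    moreover have "a \<otimes> c21 \<preceq> v"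
    proof -
      have "v = a \<otimes> c21 \<otimes> c22"
        using \<open>a \<otimes> (inv a \<otimes> v) = v\<close> 1(6) cc c by (simp add: H.m_assoc)
      then show ?thesis
        using H.ple_mult_pos[OF H.mult_pos_cone[OF a(1) 1(3)] 1(4)] by simp
    qed
    ultimately have 21: "f a \<otimes>\<^bsub>P\<^esub> f c21 = f c21 \<otimes>\<^bsub>P\<^esub> f a"
      using f_mult[of a c21] f_mult[of c21 a] a 1 by simp
    \<comment> \<open>\<open>c12\<close> is a part of \<open>a\<close> and \<open>c11\<close> one of
      \<open>b\<close>, so these commute too. Hence \<open>f a\<close> is the product of
      \<open>f c11\<close> and \<open>f c12\<close> in either order and commutes with
      \<open>f c11\<close>.\<close>
    have "c11 \<otimes> c12 = c12 \<otimes> c11"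
      using H.parts_commuteD H.parts_commute_mono[OF ab] sub cc c 1 by metis
    then have "f a = f c11 \<otimes>\<^bsub>P\<^esub> f c12" "f a = f c12 \<otimes>\<^bsub>P\<^esub> f c11"
      using f_mult[of c11 c12] f_mult[of c12 c11] a 1 by simp_all
    then have 11: "f a \<otimes>\<^bsub>P\<^esub> f c11 = f c11 \<otimes>\<^bsub>P\<^esub> f a"
      using cl by (metis P.m_assoc)
    have "f b = f c11 \<otimes>\<^bsub>P\<^esub> f c21" using f_mult[of c11 c21] b 1 by simp
    then have "f a \<otimes>\<^bsub>P\<^esub> f b = f c11 \<otimes>\<^bsub>P\<^esub> (f a \<otimes>\<^bsub>P\<^esub> f c21)"
      using cl 11 by (simp add: P.m_assoc[symmetric])
    also have "\<dots> = f b \<otimes>\<^bsub>P\<^esub> f a"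
      using cl 21 \<open>f b = _\<close> by (simp add: P.m_assoc)
    finally show ?thesis .
  qed
qed

section \<open>Uniqueness and existence of the extended value on the positive cone\<close>

lemma R_closed:
  assumes "R h p"
  shows "h \<in> pos_cone H \<and> p \<in> carrier P"
  using assms by induction (auto intro: H.one_pos_cone H.mult_pos_cone f_closed)

lemma R_interval: "\<lbrakk>a \<in> pos_cone H; a \<preceq> v\<rbrakk> \<Longrightarrow> R a (f a)"
  using ext_rel.mult[OF _ _ ext_rel.one, of a H v P f] f_closed[of a]
  by (simp add: H.pos_coneD)

lemma R_mult:
  assumes "R h p" "R h' p'"
  shows "R (h \<otimes> h') (p \<otimes>\<^bsub>P\<^esub> p')"
  using assms(1)
proof induction
  case one
  then show ?case using assms(2) R_closed[OF assms(2)] by (simp add: H.pos_coneD)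
next
  case (mult a h p)
  then show ?case
    using ext_rel.mult[OF mult(1,2,4)] R_closed[OF mult(3)] R_closed[OF assms(2)]
      f_closed[of a]
    by (simp add: H.pos_coneD H.m_assoc P.m_assoc)
qed

text \<open>Refining \<open>a \<otimes> r\<close> against the head \<open>b\<close> and the tail
  \<open>h\<close> of the derivation makes \<open>c12\<close> a factor of the tail, and the
  induction hypothesis brings it to the front there. It still has to pass \<open>c21\<close>, a part
  of \<open>b\<close>; the images commute by \<open>f_commute\<close>, and the rest
  \<open>c21 \<otimes> c22\<close> is \<open>r\<close>.\<close>

lemma R_split:
  assumes "R h p" "a \<in> pos_cone H" "a \<preceq> v" "r \<in> pos_cone H" "a \<otimes> r = h"
  shows "\<exists>q. R r q \<and> p = f a \<otimes>\<^bsub>P\<^esub> q"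
  using assms
proof (induction arbitrary: a r)
  case one
  then have "a = \<one>" "r = \<one>" using H.mult_eq_one_pos by blast+
  then show ?case using ext_rel.one[of H v P f] f_one by auto
next
  case (mult b h p)
  have hp: "h \<in> pos_cone H" "p \<in> carrier P" using R_closed mult by blast+
  have "refinable H a r b h" using refine mult hp by blast
  then show ?case
  proof (cases rule: refinable_cases)
    case (1 c11 c12 c21 c22)
    have le: "c11 \<preceq> v" "c12 \<preceq> v" "c21 \<preceq> v"
      using 1(1-4) 1(5,7)[symmetric] mult.prems mult.hyps left_factor_ple right_factor_ple
      by metis+
    obtain q where q: "R c22 q" "p = f c12 \<otimes>\<^bsub>P\<^esub> q"
      using mult.IH[of c12 c22] 1 le by auto
    have cl: "f c11 \<in> carrier P" "f c12 \<in> carrier P" "f c21 \<in> carrier P" "q \<in> carrier P"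
      using f_closed le 1 R_closed[OF q(1)] by blast+
    have comm: "f c12 \<otimes>\<^bsub>P\<^esub> f c21 = f c21 \<otimes>\<^bsub>P\<^esub> f c12"
      using f_commute 1 le by blast
    have "f b \<otimes>\<^bsub>P\<^esub> p = f c11 \<otimes>\<^bsub>P\<^esub> (f c21 \<otimes>\<^bsub>P\<^esub> f c12) \<otimes>\<^bsub>P\<^esub> q"
      using f_mult[of c11 c21] 1 mult.hyps q cl by (simp add: P.m_assoc)
    also have "\<dots> = f a \<otimes>\<^bsub>P\<^esub> (f c21 \<otimes>\<^bsub>P\<^esub> q)"
      using f_mult[of c11 c12] 1 mult.prems cl comm[symmetric] by (simp add: P.m_assoc)
    finally show ?thesis
      using ext_rel.mult[OF 1(3) le(3) q(1)] 1(6) by blast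
  qed
qed

text \<open>\<open>R_split\<close> extracts the first factor of one derivation from the other, which
  leaves two derivations for the same remaining product.\<close>

lemma R_functional:
  assumes "R h p" "R h p'"
  shows "p = p'"
  using assms
proof (induction arbitrary: p')
  case one
  \<comment> \<open>A derivation of \<open>\<one>\<close> can have factors, but a product of
    positive elements is \<open>\<one>\<close> only if every factor is.\<close>
  have "p = \<one>\<^bsub>P\<^esub>" if "R h p" "h = \<one>" for h p
    using that
  proof induction
    case (mult a h p)
    then have "a = \<one>" "h = \<one>" using H.mult_eq_one_pos R_closed by blast+
    then show ?case using mult f_one by simp
  qed simp
  then show ?case using one by simp
next
  case (mult a h p)
  obtain q where "R h q" "p' = f a \<otimes>\<^bsub>P\<^esub> q"
    using R_split[OF mult.prems mult.hyps(1,2)] R_closed[OF mult.hyps(3)] by blast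
  then show ?case using mult.IH by blast
qed

text \<open>Refining \<open>h\<close> and its complement \<open>r\<close> in
  \<open>v [^] Suc k\<close> against \<open>v\<close> and \<open>v [^] k\<close> cuts
  \<open>h\<close> into a head below \<open>v\<close> and a tail below
  \<open>v [^] k\<close>.\<close>

lemma R_total_power:
  fixes k :: nat
  assumes "h \<in> pos_cone H" "h \<preceq> v [^] k"
  shows "\<exists>p. R h p"
  using assms
proof (induction k arbitrary: h)
  case 0
  then have "h = \<one>" using H.ple_antisym[of h \<one>] by (simp add: H.pos_coneD)
  then show ?case using ext_rel.one[of H v P f] by blast
next
  case (Suc k)
  have vc: "v \<in> carrier H" and hc: "h \<in> carrier H"
    using v_pos Suc.prems H.pos_coneD by blast+
  have vk: "v [^] k \<in> pos_cone H" for k :: nat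
    by (induction k) (use v_pos in \<open>auto intro: H.one_pos_cone H.mult_pos_cone\<close>)
  define r where "r = inv h \<otimes> v [^] Suc k"
  have r: "r \<in> pos_cone H"
    unfolding r_def using H.ple_iff_pos_cone(1) hc vc Suc.prems(2) by blast
  have "h \<otimes> r = v [^] Suc k"
    using hc vc by (simp add: r_def H.m_assoc[symmetric] del: H.nat_pow_Suc)
  also have "\<dots> = v \<otimes> v [^] k" using H.nat_pow_Suc2[OF vc] .
  finally have "refinable H h r v (v [^] k)"
    using refine r vk v_pos Suc.prems by blast
  then show ?case
  proof (cases rule: refinable_cases)
    case (1 c11 c12 c21 c22)
    have "c11 \<preceq> v" "c12 \<preceq> v [^] k"
      using H.ple_mult_pos 1 by metis+
    then show ?thesis using Suc.IH[of c12] ext_rel.mult 1 by metis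
  qed
qed

end

section \<open>From the positive cone to the whole group\<close>

text \<open>Every element of a directed po-group is a fraction \<open>x \<otimes> inv y\<close> of
  positive ones, in many ways. The description is justified by
  \<open>fraction_well_defined\<close>.\<close>

definition cone_ext :: "('a, 'm) po_monoid_scheme \<Rightarrow> ('b, 'n) monoid_scheme \<Rightarrow> ('a \<Rightarrow> 'b) \<Rightarrow> 'a \<Rightarrow> 'b" where
  "cone_ext H P g h = (THE p. \<exists>x\<in>pos_cone H. \<exists>y\<in>pos_cone H.
    h = x \<otimes>\<^bsub>H\<^esub> inv\<^bsub>H\<^esub> y \<and> p = g x \<otimes>\<^bsub>P\<^esub> inv\<^bsub>P\<^esub> (g y))"

locale cone_hom = H: po_group H + P: group P
  for H :: "('a, 'm) po_monoid_scheme" (structure) and P :: "('b, 'n) monoid_scheme" +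
  fixes g :: "'a \<Rightarrow> 'b"
  assumes dir: "directed H"
    and g_closed: "x \<in> pos_cone H \<Longrightarrow> g x \<in> carrier P"
    and g_mult: "\<lbrakk>x \<in> pos_cone H; y \<in> pos_cone H\<rbrakk> \<Longrightarrow> g (x \<otimes> y) = g x \<otimes>\<^bsub>P\<^esub> g y"
begin

text \<open>The Ore condition for the positive cone: the cone is invariant under conjugation, so
  \<open>x\<close> can be moved past \<open>y\<close> at the cost of conjugating it.\<close>

lemma common_multiple:
  assumes "x \<in> pos_cone H" "y \<in> pos_cone H"
  obtains p q where "p \<in> pos_cone H" "q \<in> pos_cone H" "x \<otimes> p = y \<otimes> q"
proof
  have c: "x \<in> carrier H" "y \<in> carrier H" using assms H.pos_coneD by blast+
  show "y \<in> pos_cone H" by fact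
  show "inv y \<otimes> x \<otimes> y \<in> pos_cone H"
    using H.one_ple_conj[of x "inv y"] assms by (simp add: pos_cone_def)
  show "x \<otimes> y = y \<otimes> (inv y \<otimes> x \<otimes> y)"
    using c by (simp add: H.m_assoc[symmetric])
qed

text \<open>The denominator is an upper bound \<open>z\<close> of \<open>\<one>\<close> and
  \<open>inv h\<close>; then \<open>h \<otimes> z\<close> is positive.\<close>

lemma fraction:
  assumes "h \<in> carrier H"
  obtains x y where "x \<in> pos_cone H" "y \<in> pos_cone H" "h = x \<otimes> inv y"
proof -
  obtain z where z: "z \<in> carrier H" "\<one> \<preceq> z" "inv h \<preceq> z"
    using dir assms unfolding directed_def by (meson H.inv_closed H.one_closed)
  have "h \<otimes> z \<in> pos_cone H"
    using H.ple_iff_pos_cone(1)[of "inv h" z] assms z by simp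
  moreover have "h = (h \<otimes> z) \<otimes> inv z" using assms z by (simp add: H.m_assoc)
  ultimately show ?thesis using that z by (auto simp: pos_cone_def)
qed

text \<open>Both fractions are expanded to a common denominator
  \<open>y \<otimes> s = y' \<otimes> t\<close>. The expanded numerators are then equal, and
  \<open>g\<close> carries both equations over to \<open>P\<close>.\<close>

lemma fraction_well_defined:
  assumes p: "x \<in> pos_cone H" "y \<in> pos_cone H" "x' \<in> pos_cone H" "y' \<in> pos_cone H"
    and eq: "x \<otimes> inv y = x' \<otimes> inv y'"
  shows "g x \<otimes>\<^bsub>P\<^esub> inv\<^bsub>P\<^esub> (g y) = g x' \<otimes>\<^bsub>P\<^esub> inv\<^bsub>P\<^esub> (g y')"
proof -
  obtain s t where st: "s \<in> pos_cone H" "t \<in> pos_cone H" "y \<otimes> s = y' \<otimes> t"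
    using common_multiple p by metis
  have c: "x \<in> carrier H" "y \<in> carrier H" "x' \<in> carrier H" "y' \<in> carrier H"
    "s \<in> carrier H" "t \<in> carrier H"
    using p st H.pos_coneD by blast+
  have "x \<otimes> s = (x \<otimes> inv y) \<otimes> (y \<otimes> s)"
    using c by (simp add: H.m_assoc[symmetric]) (simp add: H.m_assoc)
  also have "\<dots> = (x' \<otimes> inv y') \<otimes> (y' \<otimes> t)" using eq st by simp
  also have "\<dots> = x' \<otimes> t"
    using c by (simp add: H.m_assoc[symmetric]) (simp add: H.m_assoc)
  finally have 1: "g x \<otimes>\<^bsub>P\<^esub> g s = g x' \<otimes>\<^bsub>P\<^esub> g t" using p st g_mult by metis
  have 2: "g y \<otimes>\<^bsub>P\<^esub> g s = g y' \<otimes>\<^bsub>P\<^esub> g t" using p st g_mult by metis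
  have gc: "g x \<in> carrier P" "g y \<in> carrier P" "g x' \<in> carrier P" "g y' \<in> carrier P"
    "g s \<in> carrier P" "g t \<in> carrier P" using p st g_closed by blast+
  have "a \<otimes>\<^bsub>P\<^esub> inv\<^bsub>P\<^esub> b = (a \<otimes>\<^bsub>P\<^esub> d) \<otimes>\<^bsub>P\<^esub> inv\<^bsub>P\<^esub> (b \<otimes>\<^bsub>P\<^esub> d)"
    if "a \<in> carrier P" "b \<in> carrier P" "d \<in> carrier P" for a b d
  proof -
    have "d \<otimes>\<^bsub>P\<^esub> (inv\<^bsub>P\<^esub> d \<otimes>\<^bsub>P\<^esub> inv\<^bsub>P\<^esub> b) = inv\<^bsub>P\<^esub> b"
      using that by (simp add: P.m_assoc[symmetric])
    then show ?thesis using that by (simp add: P.inv_mult_group P.m_assoc)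
  qed
  then show ?thesis using 1 2 gc by metis
qed

lemma cone_ext_fraction:
  assumes "x \<in> pos_cone H" "y \<in> pos_cone H"
  shows "cone_ext H P g (x \<otimes> inv y) = g x \<otimes>\<^bsub>P\<^esub> inv\<^bsub>P\<^esub> (g y)"
  unfolding cone_ext_def
proof (rule the_equality)
  show "\<exists>x'\<in>pos_cone H. \<exists>y'\<in>pos_cone H. x \<otimes> inv y = x' \<otimes> inv y' \<and>
      g x \<otimes>\<^bsub>P\<^esub> inv\<^bsub>P\<^esub> (g y) = g x' \<otimes>\<^bsub>P\<^esub> inv\<^bsub>P\<^esub> (g y')"
    using assms by blast
qed (use assms fraction_well_defined in metis)

lemma g_one: "g \<one> = \<one>\<^bsub>P\<^esub>"
  using g_mult[of \<one> \<one>] g_closed[of \<one>] H.one_pos_cone by simp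

lemma cone_ext_pos: "x \<in> pos_cone H \<Longrightarrow> cone_ext H P g x = g x"
  using cone_ext_fraction[of x \<one>] H.one_pos_cone g_closed[of x] g_one by (simp add: H.pos_coneD)

lemma cone_ext_closed: "h \<in> carrier H \<Longrightarrow> cone_ext H P g h \<in> carrier P"
  by (erule fraction) (simp add: cone_ext_fraction g_closed)

lemma cone_ext_hom: "cone_ext H P g \<in> hom H P"
proof (rule homI)
  fix h1 h2 assume h: "h1 \<in> carrier H" "h2 \<in> carrier H"
  obtain x y where xy: "x \<in> pos_cone H" "y \<in> pos_cone H" "h1 = x \<otimes> inv y"
    using fraction h by blast
  obtain z w where zw: "z \<in> pos_cone H" "w \<in> pos_cone H" "h2 = z \<otimes> inv w"
    using fraction h by blast
  obtain p q where pq: "p \<in> pos_cone H" "q \<in> pos_cone H" "y \<otimes> p = z \<otimes> q"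
    using common_multiple xy zw by metis
  \<comment> \<open>Turns a quotient with the inverse on the left into one with the inverse on the
    right. The group is arbitrary because this is needed for \<open>y\<close>, \<open>z\<close> in
    \<open>H\<close> and for their images in \<open>P\<close>.\<close>
  have swap: "inv\<^bsub>K\<^esub> b \<otimes>\<^bsub>K\<^esub> c = s \<otimes>\<^bsub>K\<^esub> inv\<^bsub>K\<^esub> t"
    if "group K" "b \<in> carrier K" "c \<in> carrier K" "s \<in> carrier K" "t \<in> carrier K"
      "b \<otimes>\<^bsub>K\<^esub> s = c \<otimes>\<^bsub>K\<^esub> t"
    for K :: "('k, 'l) monoid_scheme" and b c s t
  proof -
    interpret K: group K by fact
    have "inv\<^bsub>K\<^esub> b \<otimes>\<^bsub>K\<^esub> c = inv\<^bsub>K\<^esub> b \<otimes>\<^bsub>K\<^esub> (c \<otimes>\<^bsub>K\<^esub> t) \<otimes>\<^bsub>K\<^esub> inv\<^bsub>K\<^esub> t"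
      using that by (simp add: K.m_assoc)
    also have "\<dots> = s \<otimes>\<^bsub>K\<^esub> inv\<^bsub>K\<^esub> t"
      unfolding that(6)[symmetric] using that(2-5) by (simp add: K.m_assoc[symmetric])
    finally show ?thesis .
  qed
  have c: "x \<in> carrier H" "y \<in> carrier H" "z \<in> carrier H" "w \<in> carrier H"
    "p \<in> carrier H" "q \<in> carrier H"
    using xy zw pq H.pos_coneD by blast+
  have gc: "g x \<in> carrier P" "g y \<in> carrier P" "g z \<in> carrier P" "g w \<in> carrier P"
    "g p \<in> carrier P" "g q \<in> carrier P" using xy zw pq g_closed by blast+
  have "h1 \<otimes> h2 = x \<otimes> (inv y \<otimes> z) \<otimes> inv w" using xy zw c by (simp add: H.m_assoc)
  also have "inv y \<otimes> z = p \<otimes> inv q" using swap[OF H.is_group] c pq by blast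
  also have "x \<otimes> (p \<otimes> inv q) \<otimes> inv w = (x \<otimes> p) \<otimes> inv (w \<otimes> q)"
    using c by (simp add: H.m_assoc H.inv_mult_group)
  finally have "cone_ext H P g (h1 \<otimes> h2) = g (x \<otimes> p) \<otimes>\<^bsub>P\<^esub> inv\<^bsub>P\<^esub> (g (w \<otimes> q))"
    using cone_ext_fraction xy zw pq H.mult_pos_cone by metis
  also have "\<dots> = g x \<otimes>\<^bsub>P\<^esub> (g p \<otimes>\<^bsub>P\<^esub> inv\<^bsub>P\<^esub> (g q)) \<otimes>\<^bsub>P\<^esub> inv\<^bsub>P\<^esub> (g w)"
    using gc xy zw pq by (simp add: g_mult P.m_assoc P.inv_mult_group)
  also have "g p \<otimes>\<^bsub>P\<^esub> inv\<^bsub>P\<^esub> (g q) = inv\<^bsub>P\<^esub> (g y) \<otimes>\<^bsub>P\<^esub> g z"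
    using swap[OF P.is_group gc(2,3,5,6)] g_mult xy zw pq by metis
  finally show "cone_ext H P g (h1 \<otimes> h2) = cone_ext H P g h1 \<otimes>\<^bsub>P\<^esub> cone_ext H P g h2"
    using xy zw gc by (simp add: cone_ext_fraction P.m_assoc)
qed (rule cone_ext_closed)

end

section \<open>Isomorphisms determined by positive cones and by intervals\<close>

text \<open>In a directed po-group the positive cone determines the elements, as fractions, and the
  order, as positivity of \<open>inv x \<otimes> y\<close>.\<close>

lemma po_group_iso_if_pos_cone_iso:
  fixes H :: "('a, 'm) po_monoid_scheme" and P :: "('b, 'n) po_monoid_scheme"
  assumes H: "po_group H" "directed H" and P: "po_group P" "directed P"
    and bij: "bij_betw g (pos_cone H) (pos_cone P)"
    and mult: "\<And>x y. \<lbrakk>x \<in> pos_cone H; y \<in> pos_cone H\<rbrakk> \<Longrightarrow> g (x \<otimes>\<^bsub>H\<^esub> y) = g x \<otimes>\<^bsub>P\<^esub> g y"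
  shows "\<exists>h\<in>iso H P. (\<forall>x\<in>carrier H. \<forall>y\<in>carrier H. x \<preceq>\<^bsub>H\<^esub> y \<longleftrightarrow> h x \<preceq>\<^bsub>P\<^esub> h y) \<and>
    (\<forall>x\<in>pos_cone H. h x = g x)"
proof -
  interpret H: po_group H by fact
  interpret P: po_group P by fact
  have gP: "g x \<in> pos_cone P" if "x \<in> pos_cone H" for x
    using bij that by (auto dest: bij_betwE)
  interpret cone_hom H P g
    using H(2) gP mult by unfold_locales (auto simp: P.pos_coneD)
  \<comment> \<open>Provides \<open>fraction\<close> for \<open>P\<close>, from which surjectivity
    follows.\<close>
  interpret I: cone_hom P P id
    using P(2) by unfold_locales (auto simp: P.pos_coneD)
  define h where "h = cone_ext H P g"
  have hom: "h \<in> hom H P" unfolding h_def by (rule cone_ext_hom)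
  interpret hh: group_hom H P h using hom by unfold_locales
  have pos: "h x = g x" if "x \<in> pos_cone H" for x
    unfolding h_def using that by (rule cone_ext_pos)
  have inj: "inj_on h (carrier H)"
  proof (rule hh.inj_on_one_iff[THEN iffD2], intro allI impI)
    fix k assume k: "k \<in> carrier H" "h k = \<one>\<^bsub>P\<^esub>"
    obtain x y where xy: "x \<in> pos_cone H" "y \<in> pos_cone H" "k = x \<otimes>\<^bsub>H\<^esub> inv\<^bsub>H\<^esub> y"
      using fraction k by blast
    have "g x \<otimes>\<^bsub>P\<^esub> inv\<^bsub>P\<^esub> (g y) = \<one>\<^bsub>P\<^esub>"
      using k xy cone_ext_fraction unfolding h_def by metis
    then have "g x = g y"
      using g_closed xy by (metis P.inv_closed P.inv_equality P.inv_inv)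
    then have "x = y" using bij xy by (auto simp: bij_betw_def dest: inj_onD)
    then show "k = \<one>\<^bsub>H\<^esub>" using xy by (simp add: H.pos_coneD)
  qed
  have surj: "h ` carrier H = carrier P"
  proof
    show "carrier P \<subseteq> h ` carrier H"
    proof
      fix p assume "p \<in> carrier P"
      then obtain a b where ab: "a \<in> pos_cone P" "b \<in> pos_cone P" "p = a \<otimes>\<^bsub>P\<^esub> inv\<^bsub>P\<^esub> b"
        using I.fraction by blast
      obtain x y where xy: "x \<in> pos_cone H" "y \<in> pos_cone H" "a = g x" "b = g y"
        using bij ab unfolding bij_betw_def by (metis imageE)
      have "p = h (x \<otimes>\<^bsub>H\<^esub> inv\<^bsub>H\<^esub> y)"
        unfolding h_def using ab xy cone_ext_fraction by simp
      moreover have "x \<otimes>\<^bsub>H\<^esub> inv\<^bsub>H\<^esub> y \<in> carrier H" using xy by (simp add: H.pos_coneD)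
      ultimately show "p \<in> h ` carrier H" by blast
    qed
  qed (use hh.hom_closed in blast)
  \<comment> \<open>Positivity is reflected because \<open>g\<close> reaches every positive element
    of \<open>P\<close> and \<open>h\<close> is injective.\<close>
  have iff: "h k \<in> pos_cone P \<longleftrightarrow> k \<in> pos_cone H" if k: "k \<in> carrier H" for k
  proof
    assume "h k \<in> pos_cone P"
    then obtain x where "x \<in> pos_cone H" "h k = h x"
      using bij pos unfolding bij_betw_def by (metis imageE)
    then show "k \<in> pos_cone H" using inj k H.pos_coneD by (metis inj_onD)
  qed (use pos gP in simp)
  have "x \<preceq>\<^bsub>H\<^esub> y \<longleftrightarrow> h x \<preceq>\<^bsub>P\<^esub> h y" if "x \<in> carrier H" "y \<in> carrier H" for x y
    using that iff[of "inv\<^bsub>H\<^esub> x \<otimes>\<^bsub>H\<^esub> y"] H.ple_iff_pos_cone(1)[of x y]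
      P.ple_iff_pos_cone(1)[of "h x" "h y"] by simp
  moreover have "h \<in> iso H P" using hom inj surj by (simp add: iso_def bij_betw_def)
  ultimately show ?thesis using pos by blast
qed

text \<open>The relations built from \<open>f\<close> and from its inverse are converses of each
  other. Each is total and functional on the positive cone, so together they give a bijection of the
  cones, multiplicative by \<open>R_mult\<close>.\<close>

theorem unital_iso_if_pea_iso:
  fixes H :: "('a, 'm) po_monoid_scheme" and P :: "('b, 'n) po_monoid_scheme"
  assumes H: "unital_po_group H v" "RDP1 H" and P: "unital_po_group P u" "RDP1 P"
    and f: "f \<in> pea_iso (Gamma H v) (Gamma P u)"
  shows "unital_iso H v P u \<noteq> {}"
proof -
  interpret H: po_group H using H by (simp add: unital_po_group_def)
  interpret P: po_group P using P by (simp add: unital_po_group_def)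
  have su: "strong_unit H v" "strong_unit P u" using H P by (simp_all add: unital_po_group_def)
  then have vu: "v \<in> pos_cone H" "u \<in> pos_cone P" by (simp_all add: strong_unit_def)
  let ?A = "carrier (Gamma H v)" and ?B = "carrier (Gamma P u)"
  define f' where "f' = inv_into ?A f"
  have f1: "f \<in> pea_hom (Gamma H v) (Gamma P u)" "bij_betw f ?A ?B"
    "f' \<in> pea_hom (Gamma P u) (Gamma H v)"
    using f by (auto simp: pea_iso_def f'_def)
  have hom_interval: "interval_hom K L w k"
    if "po_group K" "po_group L" "w \<in> pos_cone K" "RDP1 K" "k \<in> pea_hom (Gamma K w) (Gamma L t)"
    for K :: "('c, 'e) po_monoid_scheme" and L :: "('d, 'f) po_monoid_scheme" and w t k
  proof -
    interpret K: po_group K by fact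
    interpret L: po_group L by fact
    have mem: "a \<in> carrier (Gamma K w) \<longleftrightarrow> a \<in> pos_cone K \<and> a \<preceq>\<^bsub>K\<^esub> w" for a
      by (auto simp: Gamma_def Let_def pos_cone_def)
    have k: "k a \<in> carrier (Gamma L t)" if "a \<in> carrier (Gamma K w)" for a
      using that \<open>k \<in> _\<close> by (auto simp: pea_hom_def)
    show ?thesis
    proof
      show "w \<in> pos_cone K" "RDP1 K" by fact+
      fix a assume a: "a \<in> pos_cone K"
      show "k a \<in> carrier L" if "a \<preceq>\<^bsub>K\<^esub> w"
        using k[of a] a that mem by (auto simp: Gamma_def Let_def)
      fix b assume b: "b \<in> pos_cone K" and le: "a \<otimes>\<^bsub>K\<^esub> b \<preceq>\<^bsub>K\<^esub> w"
      have c: "a \<in> carrier K" "b \<in> carrier K" "w \<in> carrier K"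
        using a b \<open>w \<in> _\<close> K.pos_coneD by blast+
      have "a \<preceq>\<^bsub>K\<^esub> a \<otimes>\<^bsub>K\<^esub> b" "b \<preceq>\<^bsub>K\<^esub> a \<otimes>\<^bsub>K\<^esub> b" using K.ple_mult_pos a b by blast+
      then have ab: "a \<in> carrier (Gamma K w)" "b \<in> carrier (Gamma K w)"
        using mem a b le c K.ple_trans by (meson K.m_closed)+
      have "a \<boxplus>\<^bsub>Gamma K w\<^esub> b = Some (a \<otimes>\<^bsub>K\<^esub> b)"
        using K.mult_pos_cone[OF a b] le by (simp add: Gamma_def Let_def pos_cone_def)
      then have "k a \<boxplus>\<^bsub>Gamma L t\<^esub> k b = Some (k (a \<otimes>\<^bsub>K\<^esub> b))"
        using \<open>k \<in> _\<close> ab unfolding pea_hom_def by blast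
      then show "k (a \<otimes>\<^bsub>K\<^esub> b) = k a \<otimes>\<^bsub>L\<^esub> k b"
        by (auto simp: Gamma_def Let_def split: if_splits)
    qed
  qed
  interpret F: interval_hom H P v f
    using hom_interval[OF H.po_group_axioms P.po_group_axioms vu(1) H(2) f1(1)] .
  interpret F': interval_hom P H u f'
    using hom_interval[OF P.po_group_axioms H.po_group_axioms vu(2) P(2) f1(3)] .
  have memH: "a \<in> ?A \<longleftrightarrow> a \<in> pos_cone H \<and> a \<preceq>\<^bsub>H\<^esub> v" for a
    by (auto simp: Gamma_def Let_def pos_cone_def)
  have memP: "a \<in> ?B \<longleftrightarrow> a \<in> pos_cone P \<and> a \<preceq>\<^bsub>P\<^esub> u" for a
    by (auto simp: Gamma_def Let_def pos_cone_def)
  have ff': "f' (f a) = a" "f a \<in> ?B" if "a \<in> ?A" for a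
    using that f1(2) by (auto simp: f'_def bij_betw_inv_into_left dest: bij_betwE)
  have f'f: "f (f' b) = b" "f' b \<in> ?A" if "b \<in> ?B" for b
    using that f1(2) bij_betw_inv_into[OF f1(2)]
    by (auto simp: f'_def bij_betw_inv_into_right dest: bij_betwE)
  \<comment> \<open>Applying \<open>f\<close> to each factor of \<open>h\<close> gives a
    factorization of \<open>p\<close> into elements below \<open>u\<close>, which \<open>f'\<close>
    maps back.\<close>
  have conv: "F'.R p h" if "F.R h p" for h p
    using that
  proof induction
    case (mult a h p)
    then show ?case using ext_rel.mult[of "f a" P u H f' p h] ff' memH memP by metis
  qed (rule ext_rel.one)
  have conv': "F.R h p" if "F'.R p h" for h p
    using that
  proof induction
    case (mult a h p)
    then show ?case using ext_rel.mult[of "f' a" H v P f p h] f'f memH memP by metis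
  qed (rule ext_rel.one)
  have tot: "\<exists>p. F.R h p" if "h \<in> pos_cone H" for h
    using that su(1) F.R_total_power H.pos_coneD unfolding strong_unit_def by blast
  have tot': "\<exists>h. F'.R p h" if "p \<in> pos_cone P" for p
    using that su(2) F'.R_total_power P.pos_coneD unfolding strong_unit_def by blast
  define g where "g h = (THE p. F.R h p)" for h
  have g_eq: "g h = p" if "F.R h p" for h p
    unfolding g_def using that F.R_functional by blast
  have gR: "F.R h (g h)" if "h \<in> pos_cone H" for h
    using tot[OF that] g_eq by blast
  have "bij_betw g (pos_cone H) (pos_cone P)"
    unfolding bij_betw_def
  proof
    show "inj_on g (pos_cone H)"
      using gR conv F'.R_functional by (metis inj_onI)
    show "g ` pos_cone H = pos_cone P"
    proof
      show "g ` pos_cone H \<subseteq> pos_cone P"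
        using gR conv F'.R_closed by blast
      show "pos_cone P \<subseteq> g ` pos_cone H"
        using tot' conv' g_eq F.R_closed by (metis image_eqI subsetI)
    qed
  qed
  moreover have "g (x \<otimes>\<^bsub>H\<^esub> y) = g x \<otimes>\<^bsub>P\<^esub> g y" if "x \<in> pos_cone H" "y \<in> pos_cone H" for x y
    using g_eq[OF F.R_mult[OF gR gR]] that .
  ultimately obtain h where h: "h \<in> iso H P"
    "\<forall>x\<in>carrier H. \<forall>y\<in>carrier H. x \<preceq>\<^bsub>H\<^esub> y \<longleftrightarrow> h x \<preceq>\<^bsub>P\<^esub> h y" "\<forall>x\<in>pos_cone H. h x = g x"
    using po_group_iso_if_pos_cone_iso[OF H.po_group_axioms H.strong_unit_directed[OF su(1)]
        P.po_group_axioms P.strong_unit_directed[OF su(2)], of g] by blast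
  \<comment> \<open>\<open>v\<close> lies in the interval and is its own factorization with a single
    factor.\<close>
  have "g v = f v"
    using g_eq[OF F.R_interval[OF vu(1)]] vu H.ple_refl H.pos_coneD by blast
  also have "f v = u" using f1(1) by (simp add: pea_hom_def Gamma_def Let_def)
  finally have "h \<in> unital_iso H v P u" using h vu by (simp add: unital_iso_def)
  then show ?thesis by blast
qed

section \<open>The lexicographic semidirect product\<close>

lemma carrier_lex: "carrier (lex_semidirect I phi G) = UNIV \<times> (I \<rightarrow>\<^sub>E carrier G)"
  by (simp add: lex_semidirect_def)

lemma mult_lex: "(n, x) \<otimes>\<^bsub>lex_semidirect I phi G\<^esub> (m, y) =
    (n + m, \<lambda>i\<in>I. x i \<otimes>\<^bsub>G\<^esub> y (bij_int_pow I phi n i))"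
  by (simp add: lex_semidirect_def)

lemma one_lex: "\<one>\<^bsub>lex_semidirect I phi G\<^esub> = (0, \<lambda>i\<in>I. \<one>\<^bsub>G\<^esub>)"
  by (simp add: lex_semidirect_def)

lemma ple_lex: "(n, x) \<preceq>\<^bsub>lex_semidirect I phi G\<^esub> (m, y) \<longleftrightarrow>
    n < m \<or> (n = m \<and> (\<forall>i\<in>I. x i \<preceq>\<^bsub>G\<^esub> y i))"
  by (simp add: lex_semidirect_def)

lemmas lex_simps = carrier_lex mult_lex one_lex ple_lex

locale lex_product = G: po_group G for G :: "('a, 'm) po_monoid_scheme" (structure) +
  fixes I :: "'i set" and phi :: "'i \<Rightarrow> 'i"
  assumes phi: "bij_betw phi I I"
begin

abbreviation P :: "(int \<times> ('i \<Rightarrow> 'a)) po_monoid" where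
  "P \<equiv> lex_semidirect I phi G"

abbreviation pw :: "int \<Rightarrow> 'i \<Rightarrow> 'i" where
  "pw \<equiv> bij_int_pow I phi"

lemmas pw_mem = bij_int_pow_mem[OF phi]
lemmas pw_add = bij_int_pow_add[OF phi]

lemma group_lex: "group P"
proof (rule groupI)
  fix x y assume "x \<in> carrier P" "y \<in> carrier P"
  then show "x \<otimes>\<^bsub>P\<^esub> y \<in> carrier P"
    using pw_mem by (cases x; cases y) (auto simp: lex_simps PiE_iff)
  fix z assume "z \<in> carrier P"
  then show "x \<otimes>\<^bsub>P\<^esub> y \<otimes>\<^bsub>P\<^esub> z = x \<otimes>\<^bsub>P\<^esub> (y \<otimes>\<^bsub>P\<^esub> z)"
    using \<open>x \<in> _\<close> \<open>y \<in> _\<close> pw_mem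
    by (cases x; cases y; cases z)
      (auto simp: lex_simps PiE_iff pw_add G.m_assoc intro!: restrict_ext)
next
  show "\<one>\<^bsub>P\<^esub> \<in> carrier P" by (auto simp: lex_simps)
next
  fix x assume x: "x \<in> carrier P"
  obtain n f where nf: "x = (n, f)" by (cases x)
  have f: "f \<in> I \<rightarrow>\<^sub>E carrier G" using x nf by (simp add: lex_simps)
  have "(\<lambda>i\<in>I. f i) = f" using f by (simp add: PiE_restrict)
  then show "\<one>\<^bsub>P\<^esub> \<otimes>\<^bsub>P\<^esub> x = x"
    using f nf by (auto simp: lex_simps PiE_iff bij_int_pow_0 cong: restrict_cong)
  \<comment> \<open>A left inverse suffices for \<open>groupI\<close>. In its product with
    \<open>x\<close>, entry \<open>i\<close> meets entry \<open>pw (- n) i\<close> of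
    \<open>f\<close>.\<close>
  have "(- n, \<lambda>i\<in>I. inv f (pw (- n) i)) \<in> carrier P"
    "(- n, \<lambda>i\<in>I. inv f (pw (- n) i)) \<otimes>\<^bsub>P\<^esub> x = \<one>\<^bsub>P\<^esub>"
    using f pw_mem nf by (auto simp: lex_simps PiE_iff intro!: restrict_ext)
  then show "\<exists>y\<in>carrier P. y \<otimes>\<^bsub>P\<^esub> x = \<one>\<^bsub>P\<^esub>" by blast
qed

lemma po_group_lex: "po_group P"
proof -
  interpret P: group P by (rule group_lex)
  show ?thesis
  proof
    show "partial_order_on (carrier P) {(x, y) \<in> carrier P \<times> carrier P. x \<preceq>\<^bsub>P\<^esub> y}"
      unfolding partial_order_on_def preorder_on_def
    proof (intro conjI)
      show "refl_on (carrier P) {(x, y) \<in> carrier P \<times> carrier P. x \<preceq>\<^bsub>P\<^esub> y}"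
        by (auto simp: refl_on_def lex_simps PiE_iff G.ple_refl)
      show "trans {(x, y) \<in> carrier P \<times> carrier P. x \<preceq>\<^bsub>P\<^esub> y}"
        by (rule transI) (auto simp: lex_simps PiE_iff, metis G.ple_trans)
      show "antisym {(x, y) \<in> carrier P \<times> carrier P. x \<preceq>\<^bsub>P\<^esub> y}"
        by (rule antisymI) (auto simp: lex_simps PiE_iff intro!: extensionalityI[of _ I], metis G.ple_antisym)
    qed (auto simp: refl_on_def)
  next
    fix x y a b
    assume "x \<in> carrier P" "y \<in> carrier P" "a \<in> carrier P" "b \<in> carrier P" "x \<preceq>\<^bsub>P\<^esub> y"
    then show "a \<otimes>\<^bsub>P\<^esub> x \<otimes>\<^bsub>P\<^esub> b \<preceq>\<^bsub>P\<^esub> a \<otimes>\<^bsub>P\<^esub> y \<otimes>\<^bsub>P\<^esub> b"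
      using pw_mem by (cases x; cases y; cases a; cases b)
        (auto simp: lex_simps PiE_iff intro!: G.mult_mono)
  qed
qed

sublocale P: po_group P by (rule po_group_lex)

lemma pow_unit: "(1, \<lambda>i\<in>I. \<one>) [^]\<^bsub>P\<^esub> (k :: nat) = (int k, \<lambda>i\<in>I. \<one>)"
  by (induction k) (auto simp: lex_simps pw_mem intro!: restrict_ext)

lemma unital_lex: "unital_po_group P (1, \<lambda>i\<in>I. \<one>)"
  unfolding unital_po_group_def strong_unit_def
proof (intro conjI ballI)
  show "(1, \<lambda>i\<in>I. \<one>) \<in> pos_cone P" by (auto simp: pos_cone_def lex_simps)
  fix h assume "h \<in> carrier P"
  \<comment> \<open>The exponent is one more than the level of \<open>h\<close>, or \<open>1\<close>
    for a negative level: it is strictly larger in the first component, so the sequences are not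
    compared.\<close>
  then have "h \<preceq>\<^bsub>P\<^esub> (1, \<lambda>i\<in>I. \<one>) [^]\<^bsub>P\<^esub> Suc (nat (fst h))"
    unfolding pow_unit by (cases h) (auto simp: lex_simps)
  then show "\<exists>k::nat. 1 \<le> k \<and> h \<preceq>\<^bsub>P\<^esub> (1, \<lambda>i\<in>I. \<one>) [^]\<^bsub>P\<^esub> k"
    by (metis One_nat_def Suc_le_mono zero_le)
qed (rule po_group_lex)

lemma pos_cone_lex:
  "(n, x) \<in> pos_cone P \<longleftrightarrow> 0 < n \<and> x \<in> I \<rightarrow>\<^sub>E carrier G \<or> n = 0 \<and> x \<in> I \<rightarrow>\<^sub>E pos_cone G"
  by (auto simp: pos_cone_def lex_simps PiE_iff)

end

section \<open>\<open>RDP1\<close> for the lexicographic semidirect product\<close>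

locale lex_product_RDP1 = lex_product +
  assumes rdp1: "RDP1 G" and dir: "directed G"
begin

text \<open>On level \<open>0\<close> the twist is trivial, so this is a power of \<open>G\<close>
  with coordinatewise operations, and each coordinate is refined separately.\<close>

lemma refinable_level_zero:
  assumes pos: "(0, x1) \<in> pos_cone P" "(0, x2) \<in> pos_cone P"
      "(0, y1) \<in> pos_cone P" "(0, y2) \<in> pos_cone P"
    and eq: "(0, x1) \<otimes>\<^bsub>P\<^esub> (0, x2) = (0, y1) \<otimes>\<^bsub>P\<^esub> (0, y2)"
  shows "refinable P (0, x1) (0, x2) (0, y1) (0, y2)"
proof -
  have m: "x1 \<in> I \<rightarrow>\<^sub>E pos_cone G" "x2 \<in> I \<rightarrow>\<^sub>E pos_cone G"
    "y1 \<in> I \<rightarrow>\<^sub>E pos_cone G" "y2 \<in> I \<rightarrow>\<^sub>E pos_cone G"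
    using pos by (simp_all add: pos_cone_lex)
  have "refinable G (x1 i) (x2 i) (y1 i) (y2 i)" if "i \<in> I" for i
  proof -
    have "(\<lambda>i\<in>I. x1 i \<otimes> x2 i) i = (\<lambda>i\<in>I. y1 i \<otimes> y2 i) i"
      using eq by (simp add: mult_lex bij_int_pow_0)
    then have "x1 i \<otimes> x2 i = y1 i \<otimes> y2 i" using that by simp
    moreover have "x1 i \<in> pos_cone G" "x2 i \<in> pos_cone G" "y1 i \<in> pos_cone G" "y2 i \<in> pos_cone G"
      using m that by (auto simp: PiE_iff)
    ultimately show ?thesis using rdp1 unfolding RDP1_iff_refinable by blast
  qed
  then obtain c11 c12 c21 c22 where c: "\<And>i. i \<in> I \<Longrightarrow>
      c11 i \<in> pos_cone G \<and> c12 i \<in> pos_cone G \<and> c21 i \<in> pos_cone G \<and> c22 i \<in> pos_cone G \<and>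
      x1 i = c11 i \<otimes> c12 i \<and> x2 i = c21 i \<otimes> c22 i \<and>
      y1 i = c11 i \<otimes> c21 i \<and> y2 i = c12 i \<otimes> c22 i \<and> parts_commute G (c12 i) (c21 i)"
    unfolding refinable_def Bex_def by metis
  show ?thesis
  proof (rule refinableI[of "(0, restrict c11 I)" _ "(0, restrict c12 I)" "(0, restrict c21 I)"
        "(0, restrict c22 I)"])
    show "parts_commute P (0, restrict c12 I) (0, restrict c21 I)"
      unfolding parts_commute_def
    proof (intro ballI impI)
      fix x y assume xy: "x \<in> carrier P" "y \<in> carrier P"
        and le: "\<one>\<^bsub>P\<^esub> \<preceq>\<^bsub>P\<^esub> x \<and> x \<preceq>\<^bsub>P\<^esub> (0, restrict c12 I) \<and> \<one>\<^bsub>P\<^esub> \<preceq>\<^bsub>P\<^esub> y \<and> y \<preceq>\<^bsub>P\<^esub> (0, restrict c21 I)"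
      \<comment> \<open>Between two elements of level \<open>0\<close> only level \<open>0\<close>
        occurs, so the commutation clause reduces to coordinates as well.\<close>
      obtain p q where pq: "x = (0, p)" "y = (0, q)"
        using le by (cases x; cases y) (auto simp: lex_simps)
      have "p i \<otimes> q i = q i \<otimes> p i" if "i \<in> I" for i
      proof -
        have "parts_commute G (c12 i) (c21 i)" using c that by blast
        moreover have "p i \<in> carrier G \<and> q i \<in> carrier G \<and>
            \<one> \<preceq> p i \<and> p i \<preceq> c12 i \<and> \<one> \<preceq> q i \<and> q i \<preceq> c21 i"
          using le xy pq that by (auto simp: lex_simps PiE_iff)
        ultimately show ?thesis unfolding parts_commute_def by blast
      qed
      then show "x \<otimes>\<^bsub>P\<^esub> y = y \<otimes>\<^bsub>P\<^esub> x"
        by (auto simp: pq mult_lex bij_int_pow_0 intro!: restrict_ext)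
    qed
  qed (use c m in \<open>auto simp: pos_cone_lex mult_lex bij_int_pow_0 PiE_iff
        intro!: extensionalityI[of _ I]\<close>)
qed

text \<open>\<open>z\<close> is a lower bound in every coordinate, available because
  \<open>G\<close> is directed. The remainders have level \<open>0\<close> since levels add.\<close>

lemma common_left_factor:
  assumes "(n, x) \<in> carrier P" "(n, y) \<in> carrier P"
  obtains z p q where "(n, z) \<in> carrier P" "(0, p) \<in> pos_cone P" "(0, q) \<in> pos_cone P"
    "(n, x) = (n, z) \<otimes>\<^bsub>P\<^esub> (0, p)" "(n, y) = (n, z) \<otimes>\<^bsub>P\<^esub> (0, q)"
proof -
  have "\<exists>z. z \<in> carrier G \<and> z \<preceq> x i \<and> z \<preceq> y i" if "i \<in> I" for i
    using G.directed_lower_bound[OF dir, of "x i" "y i"] assms that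
    by (auto simp: lex_simps PiE_iff)
  then obtain z where z: "\<And>i. i \<in> I \<Longrightarrow> z i \<in> carrier G \<and> z i \<preceq> x i \<and> z i \<preceq> y i"
    by metis
  have zP: "(n, restrict z I) \<in> carrier P" using z by (auto simp: lex_simps)
  have "\<exists>p. (0, p) \<in> pos_cone P \<and> (n, w) = (n, restrict z I) \<otimes>\<^bsub>P\<^esub> (0, p)"
    if w: "(n, w) \<in> carrier P" "\<And>i. i \<in> I \<Longrightarrow> z i \<preceq> w i" for w
  proof -
    have "(n, restrict z I) \<preceq>\<^bsub>P\<^esub> (n, w)" using w by (auto simp: lex_simps)
    then have pos: "inv\<^bsub>P\<^esub> (n, restrict z I) \<otimes>\<^bsub>P\<^esub> (n, w) \<in> pos_cone P"
      using P.ple_iff_pos_cone(1) zP w by blast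
    obtain k p where kp: "inv\<^bsub>P\<^esub> (n, restrict z I) \<otimes>\<^bsub>P\<^esub> (n, w) = (k, p)" by fastforce
    have e: "(n, w) = (n, restrict z I) \<otimes>\<^bsub>P\<^esub> (k, p)"
      using zP w by (simp add: kp[symmetric] P.m_assoc[symmetric])
    then have "k = 0" by (simp add: mult_lex)
    then show ?thesis using e pos kp by auto
  qed
  then show ?thesis using that[OF zP] z assms by metis
qed

text \<open>The remainders on the right are conjugated to the left by \<open>(n, z)\<close>;
  conjugation preserves positivity and the level.\<close>

lemma common_right_factor:
  assumes "(n, x) \<in> carrier P" "(n, y) \<in> carrier P"
  obtains z p q where "(n, z) \<in> carrier P" "(0, p) \<in> pos_cone P" "(0, q) \<in> pos_cone P"
    "(n, x) = (0, p) \<otimes>\<^bsub>P\<^esub> (n, z)" "(n, y) = (0, q) \<otimes>\<^bsub>P\<^esub> (n, z)"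
proof -
  obtain z p q where z: "(n, z) \<in> carrier P" "(0, p) \<in> pos_cone P" "(0, q) \<in> pos_cone P"
    "(n, x) = (n, z) \<otimes>\<^bsub>P\<^esub> (0, p)" "(n, y) = (n, z) \<otimes>\<^bsub>P\<^esub> (0, q)"
    using common_left_factor[OF assms] by metis
  have "\<exists>s. (0, s) \<in> pos_cone P \<and> (n, z) \<otimes>\<^bsub>P\<^esub> (0, r) = (0, s) \<otimes>\<^bsub>P\<^esub> (n, z)"
    if r: "(0, r) \<in> pos_cone P" for r
  proof -
    have c: "(0, r) \<in> carrier P" "\<one>\<^bsub>P\<^esub> \<preceq>\<^bsub>P\<^esub> (0, r)" using r P.pos_coneD by blast+
    obtain k s where ks: "(n, z) \<otimes>\<^bsub>P\<^esub> (0, r) \<otimes>\<^bsub>P\<^esub> inv\<^bsub>P\<^esub> (n, z) = (k, s)" by fastforce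
    have pos: "(k, s) \<in> pos_cone P"
      using P.one_ple_conj[OF c(2) z(1) c(1)] z(1) c unfolding ks[symmetric]
      by (simp add: pos_cone_def)
    have e: "(n, z) \<otimes>\<^bsub>P\<^esub> (0, r) = (k, s) \<otimes>\<^bsub>P\<^esub> (n, z)"
      unfolding ks[symmetric] using z c by (simp add: P.m_assoc)
    then have "k = 0" by (simp add: mult_lex)
    then show ?thesis using e pos by auto
  qed
  then show ?thesis using that[OF z(1)] z by metis
qed

text \<open>For \<open>n > 0\<close> a common right factor is split off; what is left is refined on
  level \<open>0\<close>, and the factor then goes back into \<open>c22\<close>.\<close>

lemma refinable_left_level_zero:
  assumes pos: "(0, x1) \<in> pos_cone P" "(n, x2) \<in> pos_cone P"
      "(0, y1) \<in> pos_cone P" "(n, y2) \<in> pos_cone P"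
    and eq: "(0, x1) \<otimes>\<^bsub>P\<^esub> (n, x2) = (0, y1) \<otimes>\<^bsub>P\<^esub> (n, y2)"
  shows "refinable P (0, x1) (n, x2) (0, y1) (n, y2)"
proof (cases "n = 0")
  case True
  then show ?thesis using refinable_level_zero assms by simp
next
  case False
  then have "0 < n" using pos by (auto simp: pos_cone_lex)
  obtain z p q where z: "(n, z) \<in> carrier P" "(0, p) \<in> pos_cone P" "(0, q) \<in> pos_cone P"
    "(n, x2) = (0, p) \<otimes>\<^bsub>P\<^esub> (n, z)" "(n, y2) = (0, q) \<otimes>\<^bsub>P\<^esub> (n, z)"
    using common_right_factor[of n x2 y2] pos P.pos_coneD by metis
  \<comment> \<open>The entries of \<open>z\<close> are mere lower bounds and may be anything; the
    level \<open>n > 0\<close> makes the element positive.\<close>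
  have zpos: "(n, z) \<in> pos_cone P" using z \<open>0 < n\<close> by (simp add: pos_cone_lex carrier_lex)
  have "(0, x1) \<otimes>\<^bsub>P\<^esub> (0, p) \<otimes>\<^bsub>P\<^esub> (n, z) = (0, y1) \<otimes>\<^bsub>P\<^esub> (0, q) \<otimes>\<^bsub>P\<^esub> (n, z)"
    using eq z pos by (simp add: P.m_assoc P.pos_coneD)
  then have "(0, x1) \<otimes>\<^bsub>P\<^esub> (0, p) = (0, y1) \<otimes>\<^bsub>P\<^esub> (0, q)"
    using z pos by (simp add: P.pos_coneD)
  then have "refinable P (0, x1) (0, p) (0, y1) (0, q)"
    using refinable_level_zero pos z by blast
  then show ?thesis using P.refinable_mult_right[OF _ zpos] z by simp
qed

text \<open>First factors on different levels are comparable, so the refinement is triangular. On a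
  common positive level a common left factor is split off, which leaves first factors of level
  \<open>0\<close>; the second factors share their level because levels add.\<close>

lemma RDP1_lex: "RDP1 P"
  unfolding RDP1_iff_refinable
proof (intro ballI impI)
  fix a1 a2 b1 b2
  assume "a1 \<in> pos_cone P" "a2 \<in> pos_cone P" "b1 \<in> pos_cone P" "b2 \<in> pos_cone P"
    and eq: "a1 \<otimes>\<^bsub>P\<^esub> a2 = b1 \<otimes>\<^bsub>P\<^esub> b2"
  moreover obtain n1 x1 n2 x2 m1 y1 m2 y2
    where ab: "a1 = (n1, x1)" "a2 = (n2, x2)" "b1 = (m1, y1)" "b2 = (m2, y2)"
    by (cases a1; cases a2; cases b1; cases b2)
  ultimately have pos: "(n1, x1) \<in> pos_cone P" "(n2, x2) \<in> pos_cone P"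
    "(m1, y1) \<in> pos_cone P" "(m2, y2) \<in> pos_cone P" by simp_all
  have c: "(n1, x1) \<in> carrier P" "(n2, x2) \<in> carrier P"
    "(m1, y1) \<in> carrier P" "(m2, y2) \<in> carrier P" using pos P.pos_coneD by blast+
  have lev: "n1 + n2 = m1 + m2" using eq ab by (simp add: mult_lex)
  consider "n1 < m1" | "m1 < n1" | "n1 = m1" "n1 = 0" | "n1 = m1" "0 < n1"
    using pos by (fastforce simp: pos_cone_lex)
  then have "refinable P (n1, x1) (n2, x2) (m1, y1) (m2, y2)"
  proof cases
    case 1
    then show ?thesis using P.refinable_if_ple pos c eq ab by (simp add: ple_lex)
  next
    case 2
    then show ?thesis
      using P.refinable_if_ple[THEN refinable_sym] pos c eq ab by (simp add: ple_lex)
  next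
    case 3
    then show ?thesis using refinable_left_level_zero pos eq ab lev by simp
  next
    case 4
    then have n2: "m2 = n2" using lev by simp
    obtain z p q where z: "(n1, z) \<in> carrier P" "(0, p) \<in> pos_cone P" "(0, q) \<in> pos_cone P"
      "(n1, x1) = (n1, z) \<otimes>\<^bsub>P\<^esub> (0, p)" "(n1, y1) = (n1, z) \<otimes>\<^bsub>P\<^esub> (0, q)"
      using common_left_factor[of n1 x1 y1] c 4 by metis
    have zpos: "(n1, z) \<in> pos_cone P" using z 4 by (simp add: pos_cone_lex carrier_lex)
    have "(n1, z) \<otimes>\<^bsub>P\<^esub> ((0, p) \<otimes>\<^bsub>P\<^esub> (n2, x2)) = (n1, z) \<otimes>\<^bsub>P\<^esub> ((0, q) \<otimes>\<^bsub>P\<^esub> (n2, y2))"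
      using eq z c 4 n2 ab by (simp add: P.m_assoc[symmetric] P.pos_coneD)
    then have "(0, p) \<otimes>\<^bsub>P\<^esub> (n2, x2) = (0, q) \<otimes>\<^bsub>P\<^esub> (n2, y2)"
      using z c n2 by (simp add: P.pos_coneD)
    then have "refinable P (0, p) (n2, x2) (0, q) (n2, y2)"
      using refinable_left_level_zero pos z n2 by blast
    then show ?thesis using P.refinable_mult_left[OF _ zpos] z 4 n2 by simp
  qed
  then show "refinable P a1 a2 b1 b2" using ab by simp
qed

end

section \<open>The kite as an interval\<close>

text \<open>\<open>pea_iso\<close> speaks of \<open>inv_into\<close>, which is shown to agree with
  \<open>k\<close> on the carrier of \<open>F\<close>; that sums stay in this carrier is an axiom of
  \<open>F\<close>.\<close>

lemma pea_isoI:
  assumes F: "pseudo_effect_algebra F"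
    and h: "h \<in> pea_hom E F" and k: "k \<in> pea_hom F E"
    and kh: "\<And>a. a \<in> carrier E \<Longrightarrow> k (h a) = a" and hk: "\<And>b. b \<in> carrier F \<Longrightarrow> h (k b) = b"
  shows "h \<in> pea_iso E F"
proof -
  interpret F: pseudo_effect_algebra F by fact
  have bij: "bij_betw h (carrier E) (carrier F)"
    by (rule bij_betw_byWitness[where f' = k]) (use h k kh hk in \<open>auto simp: pea_hom_def\<close>)
  have eq: "inv_into (carrier E) h b = k b" if "b \<in> carrier F" for b
    using that bij k hk by (intro inv_into_f_eq) (auto simp: bij_betw_def pea_hom_def)
  have "inv_into (carrier E) h \<in> pea_hom F E"
    unfolding pea_hom_def
  proof (intro CollectI conjI ballI allI impI)
    fix a b s assume ab: "a \<in> carrier F" "b \<in> carrier F" "a \<boxplus>\<^bsub>F\<^esub> b = Some s"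
    moreover have "s \<in> carrier F" using ab by (rule F.sum_closed)
    ultimately show "inv_into (carrier E) h a \<boxplus>\<^bsub>E\<^esub> inv_into (carrier E) h b =
        Some (inv_into (carrier E) h s)"
      using k eq unfolding pea_hom_def by simp
  qed (use k eq F.unit_closed in \<open>auto simp: pea_hom_def\<close>)
  then show ?thesis using h bij by (simp add: pea_iso_def)
qed

lemma pea_hom_comp:
  assumes "h \<in> pea_hom D E" "k \<in> pea_hom E F"
  shows "k \<circ> h \<in> pea_hom D F"
  using assms unfolding pea_hom_def by (auto simp: Pi_iff)

text \<open>Serves to compare two intervals through the kite: the inverse of one isomorphism is
  followed by the other.\<close>

lemma pea_isomorphic_span:
  assumes "pea_isomorphic K E" "pea_isomorphic K F"
  shows "pea_iso E F \<noteq> {}"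
proof -
  obtain f g where f: "f \<in> pea_iso K E" and g: "g \<in> pea_iso K F"
    using assms by (auto simp: pea_isomorphic_def)
  let ?f' = "inv_into (carrier K) f" and ?g' = "inv_into (carrier K) g"
  have bij: "bij_betw f (carrier K) (carrier E)" "bij_betw g (carrier K) (carrier F)"
    using f g by (simp_all add: pea_iso_def)
  have f': "?f' a \<in> carrier K \<and> f (?f' a) = a" if "a \<in> carrier E" for a
    using bij_betwE[OF bij_betw_inv_into[OF bij(1)]] bij_betw_inv_into_right[OF bij(1)] that by blast
  have g': "?g' b \<in> carrier K \<and> g (?g' b) = b" if "b \<in> carrier F" for b
    using bij_betwE[OF bij_betw_inv_into[OF bij(2)]] bij_betw_inv_into_right[OF bij(2)] that by blast
  have "g \<circ> ?f' \<in> pea_iso E F"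
  proof (rule pea_isoI)
    show "g \<circ> ?f' \<in> pea_hom E F" "f \<circ> ?g' \<in> pea_hom F E"
      using f g by (auto simp: pea_iso_def intro: pea_hom_comp)
    show "(f \<circ> ?g') ((g \<circ> ?f') a) = a" if "a \<in> carrier E" for a
      using f'[OF that] bij_betw_inv_into_left[OF bij(2), of "?f' a"] by simp
    show "(g \<circ> ?f') ((f \<circ> ?g') b) = b" if "b \<in> carrier F" for b
      using g'[OF that] bij_betw_inv_into_left[OF bij(1), of "?g' b"] by simp
  qed (use assms in \<open>simp add: pea_isomorphic_def\<close>)
  then show ?thesis by blast
qed

text \<open>The axioms for \<open>K\<close> are pulled back along \<open>h\<close>. Since
  \<open>map_option\<close> transports undefined sums too, \<open>h\<close> reflects sums as well as
  preserving them. This makes the kite a pseudo effect algebra without a direct check of the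
  axioms.\<close>

lemma pseudo_effect_algebra_transfer:
  assumes E: "pseudo_effect_algebra E"
    and bij: "bij_betw h (carrier K) (carrier E)"
    and zero: "pzero K \<in> carrier K" "h (pzero K) = pzero E"
    and unit: "punit K \<in> carrier K" "h (punit K) = punit E"
    and closed: "\<And>a b s. \<lbrakk>a \<in> carrier K; b \<in> carrier K; a \<boxplus>\<^bsub>K\<^esub> b = Some s\<rbrakk> \<Longrightarrow> s \<in> carrier K"
    and sum: "\<And>a b. \<lbrakk>a \<in> carrier K; b \<in> carrier K\<rbrakk> \<Longrightarrow>
      h a \<boxplus>\<^bsub>E\<^esub> h b = map_option h (a \<boxplus>\<^bsub>K\<^esub> b)"
  shows "pea_isomorphic K E"
proof -
  interpret E: pseudo_effect_algebra E by fact
  have inj: "h a = h b \<longleftrightarrow> a = b" if "a \<in> carrier K" "b \<in> carrier K" for a b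
    using bij that by (auto simp: bij_betw_def dest: inj_onD)
  have hE: "h a \<in> carrier E" if "a \<in> carrier K" for a
    using bij that by (auto dest: bij_betwE)
  have surj: "\<exists>a\<in>carrier K. e = h a" if "e \<in> carrier E" for e
    using bij that unfolding bij_betw_def by blast
  have sum_iff: "a \<boxplus>\<^bsub>K\<^esub> b = Some s \<longleftrightarrow> h a \<boxplus>\<^bsub>E\<^esub> h b = Some (h s)"
    if "a \<in> carrier K" "b \<in> carrier K" "s \<in> carrier K" for a b s
    using sum[OF that(1,2)] closed[OF that(1,2)] inj that(3) by (cases "a \<boxplus>\<^bsub>K\<^esub> b") auto
  have K: "pseudo_effect_algebra K"
  proof
    fix a b s assume "a \<in> carrier K" "b \<in> carrier K" "a \<boxplus>\<^bsub>K\<^esub> b = Some s"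
    then show s: "s \<in> carrier K" by (rule closed)
    obtain d f where "d \<in> carrier E" "f \<in> carrier E" "d \<boxplus>\<^bsub>E\<^esub> h a = Some (h s)" "h b \<boxplus>\<^bsub>E\<^esub> f = Some (h s)"
      using E.conjugate[of "h a" "h b" "h s"] sum_iff hE s \<open>a \<in> _\<close> \<open>b \<in> _\<close> \<open>_ = Some s\<close> by blast
    then show "\<exists>d\<in>carrier K. \<exists>f\<in>carrier K. d \<boxplus>\<^bsub>K\<^esub> a = Some s \<and> b \<boxplus>\<^bsub>K\<^esub> f = Some s"
      using surj sum_iff s \<open>a \<in> _\<close> \<open>b \<in> _\<close> by metis
  next
    fix a b c t assume abc: "a \<in> carrier K" "b \<in> carrier K" "c \<in> carrier K"
    \<comment> \<open>In the associativity axiom \<open>t\<close> is arbitrary, while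
      \<open>h\<close> is injective only on the carrier; hence membership of \<open>t\<close> is an
      explicit conjunct.\<close>
    have L: "(\<exists>s. a \<boxplus>\<^bsub>K\<^esub> b = Some s \<and> s \<boxplus>\<^bsub>K\<^esub> c = Some t) \<longleftrightarrow>
        t \<in> carrier K \<and> (\<exists>s. h a \<boxplus>\<^bsub>E\<^esub> h b = Some s \<and> s \<boxplus>\<^bsub>E\<^esub> h c = Some (h t))"
    proof (cases "a \<boxplus>\<^bsub>K\<^esub> b")
      case (Some s)
      then have "s \<in> carrier K" using closed abc by blast
      then have "s \<boxplus>\<^bsub>K\<^esub> c = Some t \<longleftrightarrow> t \<in> carrier K \<and> h s \<boxplus>\<^bsub>E\<^esub> h c = Some (h t)"
        using closed sum_iff abc by blast
      then show ?thesis using Some sum abc by simp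
    qed (use sum abc in simp)
    have R: "(\<exists>s. b \<boxplus>\<^bsub>K\<^esub> c = Some s \<and> a \<boxplus>\<^bsub>K\<^esub> s = Some t) \<longleftrightarrow>
        t \<in> carrier K \<and> (\<exists>s. h b \<boxplus>\<^bsub>E\<^esub> h c = Some s \<and> h a \<boxplus>\<^bsub>E\<^esub> s = Some (h t))"
    proof (cases "b \<boxplus>\<^bsub>K\<^esub> c")
      case (Some s)
      then have "s \<in> carrier K" using closed abc by blast
      then have "a \<boxplus>\<^bsub>K\<^esub> s = Some t \<longleftrightarrow> t \<in> carrier K \<and> h a \<boxplus>\<^bsub>E\<^esub> h s = Some (h t)"
        using closed sum_iff abc by blast
      then show ?thesis using Some sum abc by simp
    qed (use sum abc in simp)
    show "(\<exists>s. a \<boxplus>\<^bsub>K\<^esub> b = Some s \<and> s \<boxplus>\<^bsub>K\<^esub> c = Some t) \<longleftrightarrow>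
        (\<exists>s. b \<boxplus>\<^bsub>K\<^esub> c = Some s \<and> a \<boxplus>\<^bsub>K\<^esub> s = Some t)"
      unfolding L R using E.assoc abc hE by simp
  next
    fix a assume a: "a \<in> carrier K"
    show "\<exists>!d. d \<in> carrier K \<and> a \<boxplus>\<^bsub>K\<^esub> d = Some (punit K)"
      using E.right_complement[OF hE[OF a]] sum_iff[OF a _ unit(1)] unit(2) surj hE inj by metis
    show "\<exists>!f. f \<in> carrier K \<and> f \<boxplus>\<^bsub>K\<^esub> a = Some (punit K)"
      using E.left_complement[OF hE[OF a]] sum_iff[OF _ a unit(1)] unit(2) surj hE inj by metis
    assume "punit K \<boxplus>\<^bsub>K\<^esub> a \<noteq> None \<or> a \<boxplus>\<^bsub>K\<^esub> punit K \<noteq> None"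
    then have "h a = pzero E"
      using E.unit_sum[OF hE[OF a]] sum[OF a unit(1)] sum[OF unit(1) a] unit(2) by auto
    then show "a = pzero K" using inj a zero by metis
  qed (fact zero unit)+
  let ?h' = "inv_into (carrier K) h"
  have h': "?h' e \<in> carrier K" "h (?h' e) = e" if "e \<in> carrier E" for e
    using bij that bij_betw_inv_into_right bij_betw_inv_into[OF bij]
    by (auto dest: bij_betwE simp: bij_betw_inv_into_right)
  have "h \<in> pea_hom K E"
    unfolding pea_hom_def using hE sum unit by auto
  moreover have "?h' \<in> pea_hom E K"
    unfolding pea_hom_def
  proof (intro CollectI conjI ballI allI impI)
    show "?h' (punit E) = punit K"
      using bij unit by (metis bij_betw_inv_into_left)
    show "?h' a \<boxplus>\<^bsub>K\<^esub> ?h' b = Some (?h' s)"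
      if "a \<in> carrier E" "b \<in> carrier E" "a \<boxplus>\<^bsub>E\<^esub> b = Some s" for a b s
      using that h' E.sum_closed sum_iff by metis
  qed (use h' in auto)
  ultimately show ?thesis
    using K E bij unfolding pea_isomorphic_def pea_iso_def by blast
qed

text \<open>
  The lower part is embedded as it is; the upper part has to be shifted by \<open>\<lambda>\<close> to turn the
  index maps \<open>\<lambda>\<inverse>\<close>, \<open>\<rho>\<inverse>\<close> of the kite into the maps \<open>id\<close>, \<open>\<phi>\<close> of the semidirect product.
\<close>

definition kite_embed :: "'i set \<Rightarrow> ('i \<Rightarrow> 'i) \<Rightarrow> ('i \<Rightarrow> 'a) + ('i \<Rightarrow> 'a) \<Rightarrow> int \<times> ('i \<Rightarrow> 'a)" where
  "kite_embed I lam = case_sum (\<lambda>f. (0, f)) (\<lambda>x. (1, \<lambda>i\<in>I. x (lam i)))"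

text \<open>The interval consists of the positive sequences on level \<open>0\<close> and the
  negative ones on level \<open>1\<close>, the two parts of the kite. Membership of a product in it
  has to match the inequality under which a kite sum is defined.\<close>

lemma kite_isomorphic_Gamma:
  fixes G :: "('a, 'm) po_monoid_scheme" and I :: "'i set"
  assumes G: "po_group G" and lam: "bij_betw lam I I" and rho: "bij_betw rho I I"
  defines "phi \<equiv> inv_into I rho \<circ> lam"
  shows "pea_isomorphic (kite G I lam rho)
    (Gamma (lex_semidirect I phi G) (1, \<lambda>i\<in>I. \<one>\<^bsub>G\<^esub>))"
proof -
  have phi: "bij_betw phi I I"
    unfolding phi_def using bij_betw_trans[OF lam bij_betw_inv_into[OF rho]] .
  interpret lex_product G I phi
    using G phi by (simp add: lex_product_def lex_product_axioms_def)
  let ?u = "(1, \<lambda>i\<in>I. \<one>\<^bsub>G\<^esub>) :: int \<times> ('i \<Rightarrow> 'a)"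
  let ?h = "kite_embed I lam :: ('i \<Rightarrow> 'a) + ('i \<Rightarrow> 'a) \<Rightarrow> int \<times> ('i \<Rightarrow> 'a)"
  have mem: "lam i \<in> I" "inv_into I lam i \<in> I" "inv_into I rho i \<in> I" if "i \<in> I" for i
    using that lam rho bij_betw_inv_into[OF lam] bij_betw_inv_into[OF rho]
    by (auto dest: bij_betwE)
  have inv: "inv_into I lam (lam i) = i" "lam (inv_into I lam i) = i" if "i \<in> I" for i
    using that lam by (auto simp: bij_betw_inv_into_left bij_betw_inv_into_right)
  \<comment> \<open>Reindexing by \<open>lam\<close> turns conditions on kite entries into
    conditions on the shifted entries.\<close>
  have all_lam: "(\<forall>i\<in>I. Q (lam i)) \<longleftrightarrow> (\<forall>i\<in>I. Q i)" for Q
    using mem inv by metis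
  have Gam: "carrier (Gamma P ?u) =
      {0} \<times> (I \<rightarrow>\<^sub>E pos_cone G) \<union> {1} \<times> (I \<rightarrow>\<^sub>E neg_cone G)"
    by (auto simp: Gamma_def Let_def lex_simps PiE_iff pos_cone_def neg_cone_def)
  have K: "carrier (kite G I lam rho) = (I \<rightarrow>\<^sub>E pos_cone G) <+> (I \<rightarrow>\<^sub>E neg_cone G)"
    by (simp add: kite_def)
  have neg: "x \<in> carrier G \<and> x \<preceq>\<^bsub>G\<^esub> \<one>\<^bsub>G\<^esub>" if "x \<in> neg_cone G" for x
    using that by (simp add: neg_cone_def)
  have shift_unshift: "(\<lambda>i\<in>I. (\<lambda>i\<in>I. x (lam i)) (inv_into I lam i)) = x"
    and unshift_shift: "(\<lambda>i\<in>I. (\<lambda>i\<in>I. x (inv_into I lam i)) (lam i)) = x"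
    if "x \<in> extensional I" for x :: "'i \<Rightarrow> 'a"
    by (rule extensionalityI[of _ I]; use that mem inv in simp)+
  show ?thesis
  proof (rule pseudo_effect_algebra_transfer[of _ ?h])
    show "pseudo_effect_algebra (Gamma P ?u)"
      using unital_lex P.pseudo_effect_algebra_Gamma
      by (simp add: unital_po_group_def strong_unit_def)
    show "bij_betw ?h (carrier (kite G I lam rho)) (carrier (Gamma P ?u))"
    proof (rule bij_betw_byWitness[where f' =
          "\<lambda>(n, x). if n = 0 then Inl x else Inr (\<lambda>i\<in>I. x (inv_into I lam i))"])
      show "\<forall>a\<in>carrier (kite G I lam rho). (case ?h a of (n, x) \<Rightarrow>
          if n = 0 then Inl x else Inr (\<lambda>i\<in>I. x (inv_into I lam i))) = a"
        by (auto simp: K kite_embed_def PiE_iff shift_unshift simp del: restrict_apply)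
      show "\<forall>a\<in>carrier (Gamma P ?u). ?h (case a of (n, x) \<Rightarrow>
          if n = 0 then Inl x else Inr (\<lambda>i\<in>I. x (inv_into I lam i))) = a"
        by (auto simp: Gam kite_embed_def PiE_iff unshift_shift simp del: restrict_apply)
    qed (auto simp: K Gam kite_embed_def mem PiE_iff intro: extensional_arb split: if_splits)
    show "pzero (kite G I lam rho) \<in> carrier (kite G I lam rho)"
      "punit (kite G I lam rho) \<in> carrier (kite G I lam rho)"
      by (auto simp: kite_def pos_cone_def neg_cone_def G.ple_refl)
    show "?h (pzero (kite G I lam rho)) = pzero (Gamma P ?u)"
      "?h (punit (kite G I lam rho)) = punit (Gamma P ?u)"
      by (auto simp: kite_def kite_embed_def Gamma_def Let_def one_lex mem)
  next
    fix a b assume ab: "a \<in> carrier (kite G I lam rho)" "b \<in> carrier (kite G I lam rho)"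
    have Gam_sum: "p \<boxplus>\<^bsub>Gamma P ?u\<^esub> q =
        (if p \<otimes>\<^bsub>P\<^esub> q \<in> carrier (Gamma P ?u) then Some (p \<otimes>\<^bsub>P\<^esub> q) else None)" for p q
      by (simp add: Gamma_def Let_def)
    \<comment> \<open>After the shift by \<open>lam\<close>, the inverse of \<open>rho\<close> in
      the kite becomes \<open>phi\<close>, the twist that a left factor of level \<open>1\<close>
      produces in the product.\<close>
    have phi_eq: "inv_into I rho (lam i) = phi i" for i by (simp add: phi_def)
    have phi_mem: "phi i \<in> I" if "i \<in> I" for i using that phi by (auto dest: bij_betwE)
    consider (low) f g where "a = Inl f" "b = Inl g" "f \<in> I \<rightarrow>\<^sub>E pos_cone G" "g \<in> I \<rightarrow>\<^sub>E pos_cone G"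
      | (left) f x where "a = Inl f" "b = Inr x" "f \<in> I \<rightarrow>\<^sub>E pos_cone G" "x \<in> I \<rightarrow>\<^sub>E neg_cone G"
      | (right) f x where "a = Inr x" "b = Inl f" "f \<in> I \<rightarrow>\<^sub>E pos_cone G" "x \<in> I \<rightarrow>\<^sub>E neg_cone G"
      | (up) x y where "a = Inr x" "b = Inr y"
      using ab unfolding K by blast
    then have "?h a \<boxplus>\<^bsub>Gamma P ?u\<^esub> ?h b = map_option ?h (a \<boxplus>\<^bsub>kite G I lam rho\<^esub> b) \<and>
      (\<forall>s. a \<boxplus>\<^bsub>kite G I lam rho\<^esub> b = Some s \<longrightarrow> s \<in> carrier (kite G I lam rho))"
    proof cases
      case low
      then have "(\<lambda>i\<in>I. f i \<otimes>\<^bsub>G\<^esub> g i) \<in> I \<rightarrow>\<^sub>E pos_cone G"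
        by (auto simp: PiE_iff intro: G.mult_pos_cone)
      then show ?thesis
        using low by (auto simp: kite_def Gam_sum Gam kite_embed_def mult_lex bij_int_pow_0)
    next
      case left
      have fx: "f i \<in> carrier G" "x i \<in> carrier G" if "i \<in> I" for i
        using left that G.pos_coneD neg by (auto simp: PiE_iff)
      \<comment> \<open>Reindexed by \<open>lam\<close>, the kite condition compares
        \<open>f i\<close> with the inverse of \<open>x (lam i)\<close>, that is, it bounds the
        product of the two entries by \<open>\<one>\<close>.\<close>
      have "(\<forall>i\<in>I. f (inv_into I lam i) \<preceq>\<^bsub>G\<^esub> inv\<^bsub>G\<^esub> (x i)) \<longleftrightarrow> (\<forall>i\<in>I. f i \<otimes>\<^bsub>G\<^esub> x (lam i) \<preceq>\<^bsub>G\<^esub> \<one>\<^bsub>G\<^esub>)"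
        using fx mem inv G.ple_inv_iff(2)
          all_lam[of "\<lambda>i. f (inv_into I lam i) \<preceq>\<^bsub>G\<^esub> inv\<^bsub>G\<^esub> (x i)"] by simp
      then have "(1, \<lambda>i\<in>I. f i \<otimes>\<^bsub>G\<^esub> x (lam i)) \<in> carrier (Gamma P ?u) \<longleftrightarrow> (\<forall>i\<in>I. f (inv_into I lam i) \<preceq>\<^bsub>G\<^esub> inv\<^bsub>G\<^esub> (x i))"
        using fx mem by (simp add: Gam neg_cone_def PiE_iff)
      moreover have "(\<lambda>i\<in>I. f (inv_into I lam i) \<otimes>\<^bsub>G\<^esub> x i) \<in> I \<rightarrow>\<^sub>E neg_cone G" if "(\<forall>i\<in>I. f (inv_into I lam i) \<preceq>\<^bsub>G\<^esub> inv\<^bsub>G\<^esub> (x i))"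
        using that fx mem G.ple_inv_iff(2) by (simp add: neg_cone_def PiE_iff)
      moreover have "?h a \<otimes>\<^bsub>P\<^esub> ?h b = (1, \<lambda>i\<in>I. f i \<otimes>\<^bsub>G\<^esub> x (lam i))"
        using left mem by (auto simp: kite_embed_def mult_lex bij_int_pow_0 intro!: restrict_ext)
      moreover have "?h (Inr (\<lambda>i\<in>I. f (inv_into I lam i) \<otimes>\<^bsub>G\<^esub> x i)) = (1, \<lambda>i\<in>I. f i \<otimes>\<^bsub>G\<^esub> x (lam i))"
        using mem inv phi_eq by (auto simp: kite_embed_def intro!: restrict_ext)
      ultimately show ?thesis
        using left by (auto simp add: Gam_sum kite_def)
    next
      case right
      have fx: "f i \<in> carrier G" "x i \<in> carrier G" if "i \<in> I" for i
        using right that G.pos_coneD neg by (auto simp: PiE_iff)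
      have "(\<forall>i\<in>I. f (inv_into I rho i) \<preceq>\<^bsub>G\<^esub> inv\<^bsub>G\<^esub> (x i)) \<longleftrightarrow>
          (\<forall>i\<in>I. x (lam i) \<otimes>\<^bsub>G\<^esub> f (phi i) \<preceq>\<^bsub>G\<^esub> \<one>\<^bsub>G\<^esub>)"
        using fx mem phi_mem phi_eq G.ple_inv_iff(1)
          all_lam[of "\<lambda>i. f (inv_into I rho i) \<preceq>\<^bsub>G\<^esub> inv\<^bsub>G\<^esub> (x i)"] by simp
      then have "(1, \<lambda>i\<in>I. x (lam i) \<otimes>\<^bsub>G\<^esub> f (phi i)) \<in> carrier (Gamma P ?u) \<longleftrightarrow> (\<forall>i\<in>I. f (inv_into I rho i) \<preceq>\<^bsub>G\<^esub> inv\<^bsub>G\<^esub> (x i))"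
        using fx mem phi_mem by (simp add: Gam neg_cone_def PiE_iff)
      moreover have "(\<lambda>i\<in>I. x i \<otimes>\<^bsub>G\<^esub> f (inv_into I rho i)) \<in> I \<rightarrow>\<^sub>E neg_cone G" if "(\<forall>i\<in>I. f (inv_into I rho i) \<preceq>\<^bsub>G\<^esub> inv\<^bsub>G\<^esub> (x i))"
        using that fx mem G.ple_inv_iff(1) by (simp add: neg_cone_def PiE_iff)
      moreover have "?h a \<otimes>\<^bsub>P\<^esub> ?h b = (1, \<lambda>i\<in>I. x (lam i) \<otimes>\<^bsub>G\<^esub> f (phi i))"
        using right phi_mem by (auto simp: kite_embed_def mult_lex bij_int_pow_1 intro!: restrict_ext)
      moreover have "?h (Inr (\<lambda>i\<in>I. x i \<otimes>\<^bsub>G\<^esub> f (inv_into I rho i))) = (1, \<lambda>i\<in>I. x (lam i) \<otimes>\<^bsub>G\<^esub> f (phi i))"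
        using mem inv phi_eq by (auto simp: kite_embed_def intro!: restrict_ext)
      ultimately show ?thesis
        using right by (auto simp add: Gam_sum kite_def)
    next
      case up
      \<comment> \<open>The levels add up to \<open>2\<close>, above \<open>u\<close>, so the sum is
        undefined on both sides.\<close>
      then show ?thesis by (simp add: kite_def Gam_sum Gam kite_embed_def mult_lex)
    qed
    then show "?h a \<boxplus>\<^bsub>Gamma P ?u\<^esub> ?h b = map_option ?h (a \<boxplus>\<^bsub>kite G I lam rho\<^esub> b)"
      and "\<And>s. a \<boxplus>\<^bsub>kite G I lam rho\<^esub> b = Some s \<Longrightarrow> s \<in> carrier (kite G I lam rho)"
      by blast+
  qed
qed

theorem theorem3p6:
  fixes G :: "('a, 'm) po_monoid_scheme"
    and I :: "'i set" and lam rho phi :: "'i \<Rightarrow> 'i"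
    and u :: "int \<times> ('i \<Rightarrow> 'a)"
  assumes "po_group G" and "directed G" and "RDP1 G"
    and "bij_betw lam I I" and "bij_betw rho I I"
    and "phi = inv_into I rho \<circ> lam"
    and "u = (1, \<lambda>i\<in>I. \<one>\<^bsub>G\<^esub>)"
  shows "unital_po_group (lex_semidirect I phi G) u
    \<and> RDP1 (lex_semidirect I phi G)
    \<and> pea_isomorphic (kite G I lam rho) (Gamma (lex_semidirect I phi G) u)
    \<and> (\<forall>(H :: ('h, 'n) po_monoid_scheme) v.
          unital_po_group H v \<and> RDP1 H \<and> pea_isomorphic (kite G I lam rho) (Gamma H v)
          \<longrightarrow> unital_iso H v (lex_semidirect I phi G) u \<noteq> {})"
proof -
  have phi: "bij_betw phi I I"
    using bij_betw_trans[OF assms(4) bij_betw_inv_into[OF assms(5)]] assms(6) by simp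
  interpret lex_product_RDP1 G I phi
    using assms(1-3) phi
    by (simp add: lex_product_RDP1_def lex_product_def lex_product_axioms_def
        lex_product_RDP1_axioms_def)
  have unital: "unital_po_group P u" using unital_lex assms(7) by simp
  have kite: "pea_isomorphic (kite G I lam rho) (Gamma P u)"
    using kite_isomorphic_Gamma[OF assms(1,4,5)] assms(6,7) by simp
  show ?thesis
  proof (intro conjI allI impI)
    fix H :: "('h, 'n) po_monoid_scheme" and v
    assume H: "unital_po_group H v \<and> RDP1 H \<and> pea_isomorphic (kite G I lam rho) (Gamma H v)"
    then obtain f where f: "f \<in> pea_iso (Gamma H v) (Gamma P u)"
      using pea_isomorphic_span[OF _ kite] by blast
    show "unital_iso H v P u \<noteq> {}"
      by (rule unital_iso_if_pea_iso[OF _ _ unital RDP1_lex f]) (use H in auto)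
  qed (fact unital RDP1_lex kite)+
qed

end
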